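(* There is an absolute constant $d$ such that the following holds. Let $N>0$ and let $A,B\ge0$ be integers with $A+B=N$. Let $X$ be chosen uniformly at random among all strings in $\{0,1\}^N$ with exactly $A$ ones and $B$ zeros. Then for every $r\ge1$, $$\Pr_X\left[\,C_{GP}(X)\ge \tfrac12 N+\tfrac13\min(A,B)+d\sqrt{rN}\,\right]\le 2^{-r}\log N.$$
   Context: Logarithms are base $2$. The greedy-pairing algorithm on $X=X_0\cdots X_{N-1}$ maintains a list $\mathcal S=(S_1,\dots,S_\ell)$ of disjoint subsets of $\{0,\dots,N-1\}$ on which $X$ is known to be constant ($X_{S_j}$ denotes that value), initially $(\{0\},\dots,\{N-1\})$. COMBINE$(\mathcal S,i)$ queries $X_a\oplus X_b$ for some $a\in S_i,b\in S_{i+1}$; if $0$, it replaces $S_i,S_{i+1}$ by $S_i\cup S_{i+1}$ at that position; otherwise, if $|S_i|>|S_{i+1}|$ it removes $|S_{i+1}|$ elements from $S_i$ and removes $S_{i+1}$, and if $|S_i|=|S_{i+1}|$ it removes both. Let $s_1$ be the largest $t$ with $2^t\mid |S_1|$ and $s_j=\log|S_j|$ for $j\ge2$. While $\ell>0$ and $|S_1|\le\sum_{j=2}^{\ell}|S_j|$: let $i$ be the smallest $j$ with $s_j=s_{j+1}$; if $\sum_{j=1}^{i}|S_j|>\sum_{j=i+1}^{\ell}|S_j|$ reset $i:=1$; apply COMBINE$(\mathcal S,i)$. Finally output "tie" if $\mathcal S$ is empty, else $X_{S_1}$. $C_{GP}(X)$ denotes the number of XOR queries (COMBINE operations) it makes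 on input $X$. *)

theory Defs
  imports Complex_Main
begin

text \<open>Greedy-pairing algorithm. The input string is a bool list X (True = 1).
  The list S = (S_1,...,S_l) of disjoint index sets is represented as a list of
  (distinct) index lists; S_j is S ! (j - 1) (1-indexed as in the paper).\<close>

text \<open>COMBINE(S,i), for 1 \<le> i < l. The query X_a xor X_b uses a = first element of S_i,
  b = first element of S_(i+1); the answer does not depend on this choice since X is constant
  on each S_j. Removing elements removes the first ones of the list. Out of range i gives [].\<close>
definition combine :: "bool list \<Rightarrow> nat list list \<Rightarrow> nat \<Rightarrow> nat list list" where
  "combine X S i =
    (if 1 \<le> i \<and> i < length S then
       (let Si = S ! (i - 1); Sj = S ! i; pre = take (i - 1) S; post = drop (i + 1) S in
        if (X ! hd Si \<noteq> X ! hd Sj) = False then pre @ [Si @ Sj] @ post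
        else if length Si > length Sj then pre @ [drop (length Sj) Si] @ post
        else if length Si = length Sj then pre @ post
        else pre @ [drop (length Si) Sj] @ post)
     else [])"

definition s_val :: "nat list list \<Rightarrow> nat \<Rightarrow> real" where
  "s_val S j = (if j = 1 then real (GREATEST t. (2::nat) ^ t dvd length (S ! 0))
                else log 2 (real (length (S ! (j - 1)))))"

definition pick_i :: "nat list list \<Rightarrow> nat" where
  "pick_i S =
    (let l = length S; P = (\<lambda>j. 1 \<le> j \<and> j < l \<and> s_val S j = s_val S (j + 1)) in
     if \<exists>j. P j then
       (let i = (LEAST j. P j) in
        if (\<Sum>j = 1..i. length (S ! (j - 1))) > (\<Sum>j = i + 1..l. length (S ! (j - 1)))
        then 1 else i)
     else 1)"

lemma length_combine_less: "S \<noteq> [] \<Longrightarrow> length (combine X S i) < length S"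
  by (auto simp: combine_def Let_def min_def)

function gp_count :: "bool list \<Rightarrow> nat list list \<Rightarrow> nat" where
  "gp_count X S =
    (if S \<noteq> [] \<and> length (S ! 0) \<le> (\<Sum>j = 2..length S. length (S ! (j - 1)))
     then Suc (gp_count X (combine X S (pick_i S)))
     else 0)"
  by pat_completeness auto
termination
  by (relation "measure (\<lambda>(X, S). length S)") (auto simp: length_combine_less)

definition C_GP :: "bool list \<Rightarrow> nat" where
  "C_GP X = gp_count X (map (\<lambda>k. [k]) [0..<length X])"

definition strings_with :: "nat \<Rightarrow> nat \<Rightarrow> bool list set" where
  "strings_with N A = {X. length X = N \<and> count_list X True = A}"

end

(* Until the reset rule first fires, the algorithm runs like a binary counter: the processed prefix
   is a stack of monochromatic blocks of strictly decreasing powers of two, and its queries are those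
   of repeated pairing, where the survivors of each round of pairs are paired in the next round.
   Queries preserve the signed balance (ones minus zeros), so as soon as the balance of a prefix
   exceeds the number of remaining elements, nothing beyond that prefix is touched again. Every
   stacked block stems from an interval whose balance is the signed size of the block. Hence, if all
   prefix balances stay within O(sqrt(rN)) of the linear trend, the stack contains few
   minority elements, the first reset happens O(sqrt(rN)) before the decision time
   T = N / (1 + |D| / N) + O(sqrt(rN)), with D the total balance, and the queries from then on are
   O(sqrt(rN)). Repeated pairing of n random elements of balance E needs on average at most (2n + |E|) / 3
   queries: this potential decreases in expectation along the rounds, because balances halve exactly.
   With n = T and E = T D / N this is at most N/2 + min(A,B)/3 + O(sqrt(rN)).
   Both concentration statements come from exponential supermartingales for sampling without
   replacement. *)

theory Submission
  imports Defs
begin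

section \<open>Uniform strings of given balance\<close>

text \<open>The moment of the reset is random and depends on the whole string, so pair counts up to
  that moment have no tractable law. The proof therefore cuts at a fixed length \<open>T\<close>: on
  a likely event the real run costs no more than repeated pairing of the first \<open>T\<close>
  letters plus the error terms, and that prefix is uniform given its own balance. Randomness then
  enters only through prefix balances and through the pair counts of one fixed prefix. The potential
  (2n + |E|)/3 is forced. A round costs n/2 and leaves on average at most (n + |E|)/4 survivors of
  balance E/2, and n/2 + (2(n + |E|)/4 + |E|/2)/3 is again (2n + |E|)/3. Its exponential moment
  handles all rounds at once, so no union bound over rounds is paid. Probabilities are kept as
  cardinalities: a supermartingale is an inequality between values weighted by \<open>nstrs\<close>.
  This avoids conditioning and includes empty classes, such as those of the wrong parity.\<close>

definition bal :: "bool list \<Rightarrow> int" where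
  "bal X = (\<Sum>x\<leftarrow>X. if x then 1 else - 1)"

lemma bal_simps [simp]:
  "bal [] = 0" "bal (x # X) = (if x then 1 else - 1) + bal X" "bal (X @ Y) = bal X + bal Y"
  by (auto simp: bal_def)

lemma bal_rev [simp]: "bal (rev X) = bal X"
  by (simp add: bal_def rev_map [symmetric] sum_list_rev)

lemma bal_eq_count: "bal X = 2 * int (count_list X True) - int (length X)"
  by (induction X) auto

lemma abs_bal_le: "\<bar>bal X\<bar> \<le> int (length X)"
  by (induction X) auto

definition strs :: "nat \<Rightarrow> int \<Rightarrow> bool list set" where
  "strs n D = {X. length X = n \<and> bal X = D}"

lemma strings_with_eq: "strings_with N A = strs N (2 * int A - int N)"
  by (auto simp: strings_with_def strs_def bal_eq_count)

lemma finite_strs [simp]: "finite (strs n D)"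
proof (rule finite_subset)
  show "finite {X::bool list. set X \<subseteq> UNIV \<and> length X = n}"
    by (rule finite_lists_length_eq) simp
qed (auto simp: strs_def)

lemma strs_0: "strs 0 D = (if D = 0 then {[]} else {})"
  by (auto simp: strs_def)

lemma strs_Suc: "strs (Suc n) D = (#) True ` strs n (D - 1) \<union> (#) False ` strs n (D + 1)"
  by (auto simp: strs_def length_Suc_conv image_iff split: if_splits)

lemma rev_strs: "rev ` strs n D = strs n D"
proof -
  have "rev ` strs n D \<subseteq> strs n D" by (auto simp: strs_def)
  moreover have "X \<in> rev ` strs n D" if "X \<in> strs n D" for X
    using that by (intro image_eqI[of _ _ "rev X"]) (auto simp: strs_def)
  ultimately show ?thesis by auto
qed

lemma sum_strs_Suc:
  "sum f (strs (Suc n) D) =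
     (\<Sum>X\<in>strs n (D - 1). f (True # X)) + (\<Sum>X\<in>strs n (D + 1). f (False # X))"
  unfolding strs_Suc by (subst sum.union_disjoint) (auto simp: sum.reindex)

lemma sum_strs_rev: "(\<Sum>X\<in>strs n D. f (rev X)) = sum f (strs n D)"
proof -
  have "sum f (rev ` strs n D) = (\<Sum>X\<in>strs n D. f (rev X))"
    by (subst sum.reindex) (auto simp: inj_on_def)
  then show ?thesis by (simp add: rev_strs)
qed

lemma sum_strs_snoc:
  "sum f (strs (Suc n) D) =
     (\<Sum>X\<in>strs n (D - 1). f (X @ [True])) + (\<Sum>X\<in>strs n (D + 1). f (X @ [False]))"
proof -
  have "sum f (strs (Suc n) D) = (\<Sum>X\<in>strs (Suc n) D. f (rev X))" by (simp add: sum_strs_rev)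
  also have "\<dots> = (\<Sum>X\<in>strs n (D - 1). f (rev X @ [True])) + (\<Sum>X\<in>strs n (D + 1). f (rev X @ [False]))"
    by (simp add: sum_strs_Suc)
  also have "\<dots> = (\<Sum>X\<in>strs n (D - 1). f (X @ [True])) + (\<Sum>X\<in>strs n (D + 1). f (X @ [False]))"
    by (simp only: sum_strs_rev[of "\<lambda>X. f (X @ [True])"] sum_strs_rev[of "\<lambda>X. f (X @ [False])"])
  finally show ?thesis .
qed

definition nstrs :: "nat \<Rightarrow> int \<Rightarrow> real" where
  "nstrs n D = real (card (strs n D))"

lemma nstrs_nonneg [simp]: "0 \<le> nstrs n D"
  by (simp add: nstrs_def)

lemma nstrs_Suc: "nstrs (Suc n) D = nstrs n (D - 1) + nstrs n (D + 1)"
  using sum_strs_Suc[of "\<lambda>_. 1::real" n D] by (simp add: nstrs_def)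

lemma nstrs_pos_imp: "nstrs n D \<noteq> 0 \<Longrightarrow> \<bar>D\<bar> \<le> int n"
  using abs_bal_le by (fastforce simp: nstrs_def strs_def card_eq_0_iff)

text \<open>This is k C(n+1,k) = (n+1) C(n,k-1) with n + 1 + D = 2k, that is, the chance that a
  given letter is a one. Induction over the balance recurrence replaces binomials, so wrong parities
  and balances out of range need no separate treatment.\<close>

lemma nstrs_absorb_plus:
  "(real n + 1 + of_int D) * nstrs (Suc n) D = 2 * (real n + 1) * nstrs n (D - 1)"
proof (induction n arbitrary: D)
  case 0
  show ?case unfolding nstrs_Suc by (auto simp: nstrs_def strs_0)
next
  case (Suc n)
  have minus: "(real n + 1 - of_int E) * nstrs (Suc n) E = 2 * (real n + 1) * nstrs n (E + 1)" for E
    using Suc[of E] nstrs_Suc[of n E] by (simp add: algebra_simps)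
  have "(real n + 2 + of_int D) * nstrs (Suc n) (D + 1) = (real n + 2 - of_int D) * nstrs (Suc n) (D - 1)"
    using Suc[of "D + 1"] minus[of "D - 1"] by (simp add: algebra_simps)
  then show ?case
    by (simp only: nstrs_Suc[of "Suc n"] of_nat_Suc) (simp only: algebra_simps)
qed

lemma nstrs_absorb_minus:
  "(real n + 1 - of_int D) * nstrs (Suc n) D = 2 * (real n + 1) * nstrs n (D + 1)"
  using nstrs_absorb_plus[of n D] nstrs_Suc[of n D] by (simp add: algebra_simps)

text \<open>A prefix of a uniform string is a mixture of uniform strings of various balances, so a
  bound that holds for every balance passes to prefixes.\<close>

lemma sum_take_le:
  assumes "\<And>D. sum f (strs T D) \<le> c * nstrs T D"
  shows "(\<Sum>X\<in>strs (T + k) D. f (take T X)) \<le> c * nstrs (T + k) D"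
proof (induction k arbitrary: D)
  case 0
  have "(\<Sum>X\<in>strs T D. f (take T X)) = sum f (strs T D)"
    by (intro sum.cong) (auto simp: strs_def)
  then show ?case using assms by simp
next
  case (Suc k)
  have *: "(\<Sum>X\<in>strs (T + k) E. f (take T (X @ [b]))) = (\<Sum>X\<in>strs (T + k) E. f (take T X))" for E b
    by (intro sum.cong) (auto simp: strs_def)
  show ?case
    using Suc[of "D - 1"] Suc[of "D + 1"]
    by (simp add: sum_strs_snoc nstrs_Suc[of "T + k"] algebra_simps *[simplified] del: take_append)
      (simp only: * )
qed

section \<open>Exponential moment of a bounded centred step\<close>

lemma exp_le_quadratic:
  fixes x :: real
  assumes "\<bar>x\<bar> \<le> 1"
  shows "exp x \<le> 1 + x + x\<^sup>2"
proof (cases "x \<ge> 0")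
  case True
  then show ?thesis using exp_bound[of x] assms by simp
next
  case False
  define y where "y = - x"
  have y: "0 \<le> y" "y \<le> 1" using False assms by (auto simp: y_def)
  have "1 + y + y\<^sup>2 / 2 \<le> exp y" using exp_lower_Taylor_quadratic[of y] y by simp
  \<comment> \<open>The product of the claimed upper bound for exp (-y) with a lower bound for exp y
    expands to 1 plus nonnegative terms.\<close>
  moreover have "1 \<le> (1 - y + y\<^sup>2) * (1 + y + y\<^sup>2 / 2)"
  proof -
    have "(1 - y + y\<^sup>2) * (1 + y + y\<^sup>2 / 2) = 1 + y\<^sup>2 / 2 + y^3 / 2 + y^4/2"
      by (simp add: field_simps power2_eq_square power3_eq_cube power4_eq_xxxx)
    then show ?thesis using y by simp
  qed
  moreover have "0 < 1 - y + y\<^sup>2" using y by (cases "y = 1") (auto intro: add_pos_nonneg)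
  ultimately have "1 \<le> (1 - y + y\<^sup>2) * exp y"
    by (meson less_imp_le mult_left_mono order_trans)
  then have "exp (- y) \<le> 1 - y + y\<^sup>2"
    by (simp add: exp_minus divide_simps)
  then show ?thesis by (simp add: y_def)
qed

text \<open>Three weights suffice for both uses: revealing one letter has two outcomes, revealing a
  pair has three. Size bounds are asked only of outcomes with nonzero weight, because the increments
  are unbounded at impossible balances.\<close>

lemma exp_mean_le:
  fixes p q s :: real
  assumes "0 \<le> p" "0 \<le> q" "0 \<le> s" "p + q + s = w" "p * x + q * y + s * z = 0"
    "p \<noteq> 0 \<longrightarrow> \<bar>x\<bar> \<le> c" "q \<noteq> 0 \<longrightarrow> \<bar>y\<bar> \<le> c" "s \<noteq> 0 \<longrightarrow> \<bar>z\<bar> \<le> c" "c \<le> 1"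
  shows "p * exp x + q * exp y + s * exp z \<le> w * exp (c\<^sup>2)"
proof -
  have *: "p * exp x \<le> p * (1 + x + c\<^sup>2)" if "0 \<le> p" "p \<noteq> 0 \<longrightarrow> \<bar>x\<bar> \<le> c" for p x :: real
  proof (cases "p = 0")
    case False
    then have "\<bar>x\<bar> \<le> c" using that by auto
    then have "x\<^sup>2 \<le> c\<^sup>2" by (metis abs_ge_zero power2_abs power_mono)
    then have "exp x \<le> 1 + x + c\<^sup>2" using exp_le_quadratic[of x] \<open>\<bar>x\<bar> \<le> c\<close> assms(9) by linarith
    then show ?thesis using that by (simp add: mult_left_mono)
  qed simp
  have "p * exp x + q * exp y + s * exp z \<le> p * (1 + x + c\<^sup>2) + q * (1 + y + c\<^sup>2) + s * (1 + z + c\<^sup>2)"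
    using *[of p x] *[of q y] *[of s z] assms by linarith
  also have "\<dots> = w * (1 + c\<^sup>2)" using assms(4,5) by (auto simp: algebra_simps)
  also have "\<dots> \<le> w * exp (c\<^sup>2)" using assms by (intro mult_left_mono) auto
  finally show ?thesis .
qed

section \<open>Fluctuations of prefix balances\<close>

text \<open>Ville's inequality in counting form. Letters are revealed from the front, the state is
  the length and balance of the remainder, and \<open>V\<close> is a supermartingale of that state.
  The induction stops at the first bad state, where \<open>V\<close> is at least 1.\<close>

lemma maximal_inequality:
  fixes V :: "nat \<Rightarrow> int \<Rightarrow> real"
  assumes nonneg: "\<And>n E. 0 \<le> V n E"
    and step: "\<And>n E. n0 \<le> n \<Longrightarrow> n < n0 + k \<Longrightarrow>
      nstrs n (E - 1) * V n (E - 1) + nstrs n (E + 1) * V n (E + 1) \<le> nstrs (Suc n) E * V (Suc n) E"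
    and bad: "\<And>n E. n0 \<le> n \<Longrightarrow> n \<le> n0 + k \<Longrightarrow> bad n E \<Longrightarrow> 1 \<le> V n E"
  shows "real (card {X \<in> strs (n0 + k) E. \<exists>s\<le>k. bad (n0 + k - s) (bal (drop s X))})
           \<le> nstrs (n0 + k) E * V (n0 + k) E"
  using step bad
proof (induction k arbitrary: E)
  case (0 E)
  show ?case
  proof (cases "bad n0 E")
    case True
    have "real (card {X \<in> strs (n0 + 0) E. \<exists>s\<le>0. bad (n0 + 0 - s) (bal (drop s X))}) \<le> nstrs n0 E * 1"
      unfolding nstrs_def by (auto intro!: card_mono)
    also have "\<dots> \<le> nstrs n0 E * V n0 E" using 0(2)[of n0 E] True by (intro mult_left_mono) auto
    finally show ?thesis by simp
  next
    case False
    then have empty: "{X \<in> strs (n0 + 0) E. \<exists>s\<le>0. bad (n0 + 0 - s) (bal (drop s X))} = {}"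
      by (auto simp: strs_def)
    show ?thesis unfolding empty using nonneg by simp
  qed
next
  case (Suc k E)
  let ?S = "\<lambda>k E. {X \<in> strs (n0 + k) E. \<exists>s\<le>k. bad (n0 + k - s) (bal (drop s X))}"
  show ?case
  proof (cases "bad (n0 + Suc k) E")
    case True
    have "real (card (?S (Suc k) E)) \<le> nstrs (n0 + Suc k) E * 1"
      unfolding nstrs_def by (auto intro!: card_mono)
    also have "\<dots> \<le> nstrs (n0 + Suc k) E * V (n0 + Suc k) E"
      using Suc.prems(2)[of "n0 + Suc k" E] True by (intro mult_left_mono) auto
    finally show ?thesis by simp
  next
    case False
    have "?S (Suc k) E \<subseteq> (#) True ` ?S k (E - 1) \<union> (#) False ` ?S k (E + 1)"
    proof
      fix X assume "X \<in> ?S (Suc k) E"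
      then obtain s where X: "X \<in> strs (n0 + Suc k) E" "s \<le> Suc k" "bad (n0 + Suc k - s) (bal (drop s X))"
        by auto
      then have "s \<noteq> 0" using False by (intro notI) (auto simp: strs_def)
      then obtain s' where s': "s = Suc s'" by (cases s) auto
      from X(1) consider Y where "X = True # Y" "Y \<in> strs (n0 + k) (E - 1)"
        | Y where "X = False # Y" "Y \<in> strs (n0 + k) (E + 1)"
        by (auto simp: strs_Suc)
      then show "X \<in> (#) True ` ?S k (E - 1) \<union> (#) False ` ?S k (E + 1)"
        using X s' by cases (auto intro!: exI[of _ s'])
    qed
    then have "card (?S (Suc k) E) \<le> card ((#) True ` ?S k (E - 1) \<union> (#) False ` ?S k (E + 1))"
      by (intro card_mono) auto
    also have "\<dots> \<le> card (?S k (E - 1)) + card (?S k (E + 1))"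
      by (rule order_trans[OF card_Un_le]) (intro add_mono card_image_le; simp)
    finally have "real (card (?S (Suc k) E)) \<le> real (card (?S k (E - 1))) + real (card (?S k (E + 1)))"
      by linarith
    also have "\<dots> \<le> nstrs (n0 + k) (E - 1) * V (n0 + k) (E - 1) + nstrs (n0 + k) (E + 1) * V (n0 + k) (E + 1)"
      using Suc.prems by (intro add_mono Suc.IH) auto
    also have "\<dots> \<le> nstrs (Suc (n0 + k)) E * V (Suc (n0 + k)) E"
      by (rule Suc.prems(1)) auto
    finally show ?thesis by simp
  qed
qed

text \<open>The density E/n of the unrevealed part is a martingale. Scaled by N, its step has size N
  |e - (d+1)| / (d(d+1)) or N |e + (d+1)| / (d(d+1)), which is at most 4 as long as n is at least
  N/2. The term 16 \<theta>^2 n releases (4 \<theta>)^2 per letter and pays for the convexity of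
  exp.\<close>

lemma density_step:
  fixes N n :: nat and \<theta> \<sigma> c :: real
  assumes n: "0 < n" "N \<le> 2 * n" and \<theta>: "0 \<le> \<theta>" "4 * \<theta> \<le> 1" and \<sigma>: "\<bar>\<sigma>\<bar> = 1"
  defines "V \<equiv> \<lambda>n (E::int). exp (\<theta> * \<sigma> * N * (of_int E / real n) + c + 16 * \<theta>\<^sup>2 * n)"
  shows "nstrs n (E - 1) * V n (E - 1) + nstrs n (E + 1) * V n (E + 1) \<le> nstrs (Suc n) E * V (Suc n) E"
proof -
  define w where "w = nstrs (Suc n) E"
  define p where "p = nstrs n (E - 1)"
  define q where "q = nstrs n (E + 1)"
  define d where "d = real n"
  define e where "e = real_of_int E"
  define x where "x = \<theta> * \<sigma> * N * ((e - 1) / d - e / (d + 1))"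
  define y where "y = \<theta> * \<sigma> * N * ((e + 1) / d - e / (d + 1))"
  have d: "d \<ge> 1" "real N \<le> 2 * d" using n by (auto simp: d_def)
  have pq: "p + q = w" by (simp add: p_def q_def w_def nstrs_Suc)
  have pw: "(d + 1 + e) * w = 2 * (d + 1) * p"
    using nstrs_absorb_plus[of n E] by (simp add: p_def w_def d_def e_def)
  have qw: "(d + 1 - e) * w = 2 * (d + 1) * q"
    using nstrs_absorb_minus[of n E] by (simp add: q_def w_def d_def e_def)
  have ex: "(e - 1) / d - e / (d + 1) = (e - (d + 1)) / (d * (d + 1))"
    using d by (simp add: field_simps)
  have ey: "(e + 1) / d - e / (d + 1) = (e + (d + 1)) / (d * (d + 1))"
    using d by (simp add: field_simps)
  have centred: "p * x + q * y = 0"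
  proof -
    have "p * (t * (u / m)) + q * (t * (v / m)) = t * ((p * u + q * v) / m)" for t u v m
      by (simp add: add_divide_distrib algebra_simps)
    then have "p * x + q * y = \<theta> * \<sigma> * N * ((p * (e - (d + 1)) + q * (e + (d + 1))) / (d * (d + 1)))"
      unfolding x_def y_def ex ey by blast
    moreover have "2 * (d + 1) * (p * (e - (d + 1)) + q * (e + (d + 1))) = 0"
    proof -
      have "2 * (d + 1) * (p * (e - (d + 1)) + q * (e + (d + 1)))
          = (2 * (d + 1) * p) * (e - (d + 1)) + (2 * (d + 1) * q) * (e + (d + 1))"
        by (simp add: algebra_simps)
      also have "\<dots> = 0" unfolding pw[symmetric] qw[symmetric] by (simp add: algebra_simps)
      finally show ?thesis .
    qed
    ultimately show ?thesis using d by auto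
  qed
  have bound: "\<bar>\<theta> * \<sigma> * N * (f / (d * (d + 1)))\<bar> \<le> 4 * \<theta>" if "\<bar>f\<bar> \<le> 2 * d" for f
  proof -
    have "real N * \<bar>f\<bar> \<le> (2 * d) * (2 * d)" using that d by (intro mult_mono) auto
    also have "\<dots> \<le> 4 * (d * (d + 1))" using d by (simp add: algebra_simps)
    finally have "real N * \<bar>f\<bar> / (d * (d + 1)) \<le> 4" using d by (subst pos_divide_le_eq) auto
    then have "real N * (\<bar>f\<bar> / (d * (d + 1))) \<le> 4" by simp
    then have "\<theta> * (real N * (\<bar>f\<bar> / (d * (d + 1)))) \<le> \<theta> * 4" by (intro mult_left_mono \<theta>)
    then show ?thesis using \<theta> \<sigma> d by (simp add: abs_mult abs_divide mult.assoc)
  qed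
  have "p \<noteq> 0 \<longrightarrow> \<bar>x\<bar> \<le> 4 * \<theta>"
  proof
    assume "p \<noteq> 0"
    then have "\<bar>E - 1\<bar> \<le> int n" unfolding p_def by (rule nstrs_pos_imp)
    then have "\<bar>e - 1\<bar> \<le> d" by (simp add: e_def d_def)
    then show "\<bar>x\<bar> \<le> 4 * \<theta>" unfolding x_def ex by (intro bound) auto
  qed
  moreover have "q \<noteq> 0 \<longrightarrow> \<bar>y\<bar> \<le> 4 * \<theta>"
  proof
    assume "q \<noteq> 0"
    then have "\<bar>E + 1\<bar> \<le> int n" unfolding q_def by (rule nstrs_pos_imp)
    then have "\<bar>e + 1\<bar> \<le> d" by (simp add: e_def d_def)
    then show "\<bar>y\<bar> \<le> 4 * \<theta>" unfolding y_def ey by (intro bound) auto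
  qed
  ultimately have "p * exp x + q * exp y \<le> w * exp ((4 * \<theta>)\<^sup>2)"
    using exp_mean_le[of p q 0 w x y 0 "4 * \<theta>"] pq centred \<theta> by (simp add: p_def q_def)
  then have *: "(p * exp x + q * exp y) * exp (\<theta> * \<sigma> * N * (e / (d + 1)) + c + 16 * \<theta>\<^sup>2 * d)
       \<le> w * exp ((4 * \<theta>)\<^sup>2) * exp (\<theta> * \<sigma> * N * (e / (d + 1)) + c + 16 * \<theta>\<^sup>2 * d)"
    by (intro mult_right_mono) auto
  have "V n (E - 1) = exp x * exp (\<theta> * \<sigma> * N * (e / (d + 1)) + c + 16 * \<theta>\<^sup>2 * d)"
    unfolding V_def exp_add[symmetric] x_def by (simp add: e_def d_def algebra_simps)
  moreover have "V n (E + 1) = exp y * exp (\<theta> * \<sigma> * N * (e / (d + 1)) + c + 16 * \<theta>\<^sup>2 * d)"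
    unfolding V_def exp_add[symmetric] y_def by (simp add: e_def d_def algebra_simps)
  moreover have "V (Suc n) E = exp ((4 * \<theta>)\<^sup>2) * exp (\<theta> * \<sigma> * N * (e / (d + 1)) + c + 16 * \<theta>\<^sup>2 * d)"
    unfolding V_def exp_add[symmetric] by (simp add: e_def d_def algebra_simps)
  ultimately show ?thesis using * by (simp add: p_def q_def w_def algebra_simps)
qed

text \<open>The total balance is fixed, so an excess of the prefix is a deficit of the suffix, and
  the suffix is what the density martingale sees. Only the first half is reachable because
  \<open>density_step\<close> needs N \<le> 2n.\<close>

lemma half_fluctuation:
  fixes N :: nat and \<theta> \<sigma> \<beta> :: real
  assumes N: "0 < N" and \<theta>: "0 \<le> \<theta>" "4 * \<theta> \<le> 1" and \<sigma>: "\<bar>\<sigma>\<bar> = 1" and \<beta>: "0 \<le> \<beta>"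
  shows "real (card {X \<in> strs N D. \<exists>s. 2 * s \<le> N \<and> \<beta> \<le> \<sigma> * (of_int (bal (take s X)) - s * (of_int D / N))})
           \<le> nstrs N D * exp (16 * \<theta>\<^sup>2 * N - \<theta> * \<beta>)"
proof -
  define \<delta> where "\<delta> = of_int D / real N"
  define k where "k = N div 2"
  define n0 where "n0 = N - k"
  have nk: "n0 + k = N" by (simp add: n0_def k_def)
  \<comment> \<open>With this shift the density term cancels at the start, leaving 16 \<theta>^2 N -
    \<theta> \<beta>, while any bad suffix lifts the exponent to at least 0.\<close>
  define c where "c = \<theta> * \<sigma> * of_int D - \<theta> * \<beta>"
  define V where "V = (\<lambda>n (E::int). exp (\<theta> * (- \<sigma>) * N * (of_int E / real n) + c + 16 * \<theta>\<^sup>2 * n))"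
  define bad where "bad = (\<lambda>n E. \<beta> \<le> \<sigma> * (n * \<delta> - of_int E))"
  have bound: "real (card {X \<in> strs (n0 + k) D. \<exists>s\<le>k. bad (n0 + k - s) (bal (drop s X))})
           \<le> nstrs (n0 + k) D * V (n0 + k) D"
  proof (rule maximal_inequality)
    show "0 \<le> V n E" for n E by (simp add: V_def)
    show "nstrs n (E - 1) * V n (E - 1) + nstrs n (E + 1) * V n (E + 1) \<le> nstrs (Suc n) E * V (Suc n) E"
      if "n0 \<le> n" for n E
      unfolding V_def using that N \<sigma> by (intro density_step \<theta>) (auto simp: n0_def k_def)
    show "1 \<le> V n E" if "n0 \<le> n" "n \<le> n0 + k" "bad n E" for n E
    proof -
      have n: "0 < n" "n \<le> N" using that N by (auto simp: n0_def k_def)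
      have "\<beta> * 1 \<le> \<beta> * (N / n)" using n \<beta> by (intro mult_left_mono) auto
      also have "\<dots> \<le> \<sigma> * (n * \<delta> - of_int E) * (N / n)"
        using that by (intro mult_right_mono) (auto simp: bad_def)
      also have "\<dots> = \<sigma> * of_int D - \<sigma> * N * (of_int E / n)"
        using n N by (simp add: \<delta>_def field_simps)
      finally have "\<theta> * \<beta> \<le> \<theta> * (\<sigma> * of_int D - \<sigma> * N * (of_int E / n))"
        using \<theta> by (intro mult_left_mono) auto
      then have "0 \<le> \<theta> * (- \<sigma>) * N * (of_int E / real n) + c" by (simp add: c_def algebra_simps)
      then show ?thesis by (simp add: V_def add_nonneg_nonneg)
    qed
  qed
  have VN: "V N D = exp (16 * \<theta>\<^sup>2 * N - \<theta> * \<beta>)"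
    using N by (simp add: V_def c_def)
  have "(\<exists>s\<le>k. bad (N - s) (bal (drop s X)))
      \<longleftrightarrow> (\<exists>s. 2 * s \<le> N \<and> \<beta> \<le> \<sigma> * (of_int (bal (take s X)) - s * \<delta>))" if "X \<in> strs N D" for X
  proof -
    have "s \<le> k \<longleftrightarrow> 2 * s \<le> N" for s by (auto simp: k_def)
    moreover have "bad (N - s) (bal (drop s X)) \<longleftrightarrow> \<beta> \<le> \<sigma> * (of_int (bal (take s X)) - s * \<delta>)"
      if "2 * s \<le> N" for s
    proof -
      have "bal (take s X) + bal (drop s X) = D"
        using \<open>X \<in> strs N D\<close> by (metis (mono_tags) append_take_drop_id bal_simps(3) mem_Collect_eq strs_def)
      then have "real_of_int (bal (drop s X)) = of_int D - of_int (bal (take s X))" by linarith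
      moreover have "N * \<delta> = of_int D" using N by (simp add: \<delta>_def)
      moreover have "real (N - s) = real N - real s" using that by simp
      ultimately have "real (N - s) * \<delta> - of_int (bal (drop s X)) = of_int (bal (take s X)) - s * \<delta>"
        by (simp only: left_diff_distrib)
      then show ?thesis by (simp only: bad_def)
    qed
    ultimately show ?thesis by auto
  qed
  then have sets: "{X \<in> strs N D. \<exists>s\<le>k. bad (N - s) (bal (drop s X))}
      = {X \<in> strs N D. \<exists>s. 2 * s \<le> N \<and> \<beta> \<le> \<sigma> * (of_int (bal (take s X)) - s * \<delta>)}"
    by blast
  show ?thesis using bound unfolding nk sets VN unfolding \<delta>_def .
qed

lemma card_strs_rev: "card {X \<in> strs N D. P (rev X)} = card {X \<in> strs N D. P X}"
proof (rule bij_betw_same_card[of rev])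
  show "bij_betw rev {X \<in> strs N D. P (rev X)} {X \<in> strs N D. P X}"
    by (rule bij_betw_byWitness[of _ rev]) (auto simp: strs_def)
qed

text \<open>The factor 4 counts two signs for the string and two for its reversal. A prefix longer
  than N/2 deviates exactly opposite to the complementary suffix, which reversal turns into a prefix
  of length below N/2.\<close>

lemma fluctuation:
  fixes N :: nat and \<theta> \<beta> :: real
  assumes N: "0 < N" and \<theta>: "0 \<le> \<theta>" "4 * \<theta> \<le> 1" and \<beta>: "0 \<le> \<beta>"
  shows "real (card {X \<in> strs N D. \<exists>s\<le>N. \<beta> \<le> \<bar>of_int (bal (take s X)) - s * (of_int D / N)\<bar>})
           \<le> 4 * nstrs N D * exp (16 * \<theta>\<^sup>2 * N - \<theta> * \<beta>)"
proof -
  define \<delta> where "\<delta> = of_int D / real N"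
  have N\<delta>: "real N * \<delta> = of_int D" using N by (simp add: \<delta>_def)
  define dev where "dev = (\<lambda>X s. of_int (bal (take s X)) - real s * \<delta>)"
  define H where "H = (\<lambda>\<sigma> X. \<exists>s. 2 * s \<le> N \<and> \<beta> \<le> \<sigma> * dev X s)"
  have H: "real (card {X \<in> strs N D. H \<sigma> X}) \<le> nstrs N D * exp (16 * \<theta>\<^sup>2 * N - \<theta> * \<beta>)"
    if "\<bar>\<sigma>\<bar> = 1" for \<sigma>
    using half_fluctuation[OF N \<theta> that \<beta>, of D] by (simp add: H_def dev_def \<delta>_def)
  let ?A = "\<lambda>\<sigma>. {X \<in> strs N D. H \<sigma> X}" and ?B = "\<lambda>\<sigma>. {X \<in> strs N D. H \<sigma> (rev X)}"
  have "{X \<in> strs N D. \<exists>s\<le>N. \<beta> \<le> \<bar>dev X s\<bar>} \<subseteq> (?A 1 \<union> ?A (- 1)) \<union> (?B 1 \<union> ?B (- 1))"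
  proof
    fix X assume "X \<in> {X \<in> strs N D. \<exists>s\<le>N. \<beta> \<le> \<bar>dev X s\<bar>}"
    then obtain s where X: "X \<in> strs N D" "s \<le> N" "\<beta> \<le> \<bar>dev X s\<bar>" by auto
    have len: "length X = N" using X(1) by (simp add: strs_def)
    show "X \<in> (?A 1 \<union> ?A (- 1)) \<union> (?B 1 \<union> ?B (- 1))"
    proof (cases "2 * s \<le> N")
      case True
      then have "H 1 X \<or> H (- 1) X" using X by (cases "dev X s \<ge> 0") (auto simp: H_def)
      then show ?thesis using X by auto
    next
      case False
      have "bal (take s X) + bal (drop s X) = D"
        using X(1) by (metis (mono_tags) append_take_drop_id bal_simps(3) mem_Collect_eq strs_def)
      then have "real_of_int (bal (drop s X)) = of_int D - of_int (bal (take s X))" by linarith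
      moreover have "take (N - s) (rev X) = rev (drop s X)" using X len by (simp add: take_rev)
      ultimately have "dev (rev X) (N - s) = - dev X s"
        using X N\<delta> by (simp add: dev_def of_nat_diff algebra_simps)
      then have "\<exists>t. 2 * t \<le> N \<and> \<beta> \<le> \<bar>dev (rev X) t\<bar>"
        using False X by (intro exI[of _ "N - s"]) auto
      then obtain t where "2 * t \<le> N" "\<beta> \<le> \<bar>dev (rev X) t\<bar>" by auto
      then have "H 1 (rev X) \<or> H (- 1) (rev X)" by (cases "dev (rev X) t \<ge> 0") (auto simp: H_def)
      then show ?thesis using X by auto
    qed
  qed
  then have "card {X \<in> strs N D. \<exists>s\<le>N. \<beta> \<le> \<bar>dev X s\<bar>} \<le> card ((?A 1 \<union> ?A (- 1)) \<union> (?B 1 \<union> ?B (- 1)))"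
    by (intro card_mono) auto
  also have "\<dots> \<le> (card (?A 1) + card (?A (- 1))) + (card (?B 1) + card (?B (- 1)))"
    by (rule order_trans[OF card_Un_le]) (intro add_mono card_Un_le)
  also have "\<dots> = 2 * (card (?A 1) + card (?A (- 1)))" by (simp add: card_strs_rev)
  finally have "real (card {X \<in> strs N D. \<exists>s\<le>N. \<beta> \<le> \<bar>dev X s\<bar>}) \<le> real (2 * (card (?A 1) + card (?A (- 1))))"
    by (rule of_nat_mono)
  then show ?thesis using H[of 1] H[of "- 1"] by (simp add: dev_def \<delta>_def)
qed

section \<open>Queries of repeated pairing\<close>

fun red :: "bool list \<Rightarrow> bool list" where
  "red (x # y # X) = (if x = y then x # red X else red X)"
| "red _ = []"

lemma length_red_le: "length (red X) \<le> length X div 2"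
  by (induction X rule: red.induct) auto

lemma bal_red: "even (length X) \<Longrightarrow> bal X = 2 * bal (red X)"
  by (induction X rule: red.induct) auto

lemma red_snoc: "even (length X) \<Longrightarrow> red (X @ [x]) = red X"
  by (induction X rule: red.induct) auto

lemma red_snoc2: "even (length X) \<Longrightarrow> red (X @ [x, y]) = red X @ (if x = y then [x] else [])"
  by (induction X rule: red.induct) auto

function pair_queries :: "bool list \<Rightarrow> nat" where
  "pair_queries X = (if length X < 2 then 0 else length X div 2 + pair_queries (red X))"
  by pat_completeness auto
termination
proof (relation "measure length")
  fix X :: "bool list" assume "\<not> length X < 2"
  then show "(red X, X) \<in> measure length" using length_red_le[of X] by simp
qed auto

declare pair_queries.simps [simp del]

lemma pair_queries_short: "length X < 2 \<Longrightarrow> pair_queries X = 0"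
  by (simp add: pair_queries.simps)

lemma pair_queries_long: "2 \<le> length X \<Longrightarrow> pair_queries X = length X div 2 + pair_queries (red X)"
  by (subst pair_queries.simps) simp

lemma pair_queries_snoc:
  assumes "even (length X)"
  shows "pair_queries (X @ [x]) = pair_queries X"
proof (cases "length X < 2")
  case True
  then show ?thesis using assms by (cases X) (auto simp: pair_queries_short)
next
  case False
  then show ?thesis using assms by (auto simp: pair_queries_long red_snoc)
qed

text \<open>The number of even-length strings reducing to \<open>Y\<close> depends only on the length of \<open>Y\<close>, so
  \<open>red\<close> maps a uniform string of given balance to a uniform string given its length.\<close>

fun red_fibre :: "nat \<Rightarrow> nat \<Rightarrow> nat" where
  "red_fibre 0 l = (if l = 0 then 1 else 0)"
| "red_fibre (Suc k) l = 2 * red_fibre k l + (if l = 0 then 0 else red_fibre k (l - 1))"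

lemma card_red_fibre: "card {X. length X = 2 * k \<and> red X = Y} = red_fibre k (length Y)"
proof (induction k arbitrary: Y)
  case 0
  have "{X. length X = 2 * 0 \<and> red X = Y} = (if Y = [] then {[]} else {})" by auto
  then show ?case by auto
next
  case (Suc k)
  let ?F = "\<lambda>Y. {X. length X = 2 * k \<and> red X = Y}"
  have fin: "finite (?F Z)" for Z
    by (rule finite_subset[OF _ finite_lists_length_eq[of UNIV "2 * k"]]) auto
  let ?M = "(\<lambda>X. True # False # X) ` ?F Y \<union> (\<lambda>X. False # True # X) ` ?F Y"
  let ?E = "case Y of [] \<Rightarrow> {} | y # Z \<Rightarrow> (\<lambda>X. y # y # X) ` ?F Z"
  have "{X. length X = 2 * Suc k \<and> red X = Y} = ?M \<union> ?E"
  proof (intro equalityI subsetI)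
    fix X assume X: "X \<in> {X. length X = 2 * Suc k \<and> red X = Y}"
    then obtain x y X' where "X = x # y # X'" "length X' = 2 * k"
      by (auto simp: length_Suc_conv)
    then show "X \<in> ?M \<union> ?E" using X by (cases x; cases y) (auto split: list.splits)
  qed (auto split: list.splits)
  moreover have "card (?M \<union> ?E) = card ?M + card ?E"
    using fin by (intro card_Un_disjoint) (auto split: list.splits)
  moreover have "card ?M = red_fibre k (length Y) + red_fibre k (length Y)"
    using fin by (subst card_Un_disjoint) (auto simp: card_image inj_on_def Suc.IH)
  moreover have "card ?E = (if length Y = 0 then 0 else red_fibre k (length Y - 1))"
    by (auto split: list.splits simp: card_image inj_on_def Suc.IH)
  ultimately show ?case by (simp del: mult_Suc_right)
qed

text \<open>Given the number n of survivors, \<open>red X\<close> is uniform on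
  \<open>strs n E\<close>. Hence an average bound on each \<open>strs n E\<close> may be inserted
  before averaging over n.\<close>

lemma sum_red_le:
  fixes h :: "bool list \<Rightarrow> real"
  assumes h: "\<And>n. n \<le> k \<Longrightarrow> sum h (strs n E) \<le> H n * nstrs n E"
  shows "(\<Sum>X\<in>strs (2 * k) (2 * E). h (red X)) \<le> (\<Sum>X\<in>strs (2 * k) (2 * E). H (length (red X)))"
proof -
  let ?S = "strs (2 * k) (2 * E)" and ?T = "\<Union>n\<in>{..k}. strs n E"
  have sub: "red X \<in> ?T" if "X \<in> ?S" for X
    using that length_red_le[of X] bal_red[of X] by (auto simp: strs_def)
  have fibre: "{X \<in> ?S. red X = Y} = {X. length X = 2 * k \<and> red X = Y}" if "Y \<in> ?T" for Y
    using that bal_red by (auto simp: strs_def)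
  have fin: "finite ?T" by auto
  have group: "(\<Sum>X\<in>?S. g (red X)) = (\<Sum>n\<le>k. real (red_fibre k n) * sum g (strs n E))" for g :: "bool list \<Rightarrow> real"
  proof -
    have "(\<Sum>X\<in>?S. g (red X)) = (\<Sum>Y\<in>?T. \<Sum>X\<in>{X \<in> ?S. red X = Y}. g (red X))"
      by (rule sum.group[symmetric]) (use sub fin in auto)
    also have "\<dots> = (\<Sum>Y\<in>?T. real (red_fibre k (length Y)) * g Y)"
    proof (rule sum.cong)
      fix Y assume Y: "Y \<in> ?T"
      have "(\<Sum>X\<in>{X \<in> ?S. red X = Y}. g (red X)) = (\<Sum>X\<in>{X \<in> ?S. red X = Y}. g Y)"
        by (rule sum.cong) auto
      then show "(\<Sum>X\<in>{X \<in> ?S. red X = Y}. g (red X)) = real (red_fibre k (length Y)) * g Y"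
        unfolding fibre[OF Y] by (simp add: card_red_fibre)
    qed simp
    also have "\<dots> = (\<Sum>n\<le>k. \<Sum>Y\<in>strs n E. real (red_fibre k (length Y)) * g Y)"
      by (rule sum.UNION_disjoint) (auto, auto simp: strs_def)
    also have "\<dots> = (\<Sum>n\<le>k. real (red_fibre k n) * sum g (strs n E))"
      unfolding sum_distrib_left by (intro sum.cong) (auto simp: strs_def)
    finally show ?thesis .
  qed
  have "(\<Sum>Y\<in>strs n E. H (length Y)) = H n * nstrs n E" for n
  proof -
    have "(\<Sum>Y\<in>strs n E. H (length Y)) = (\<Sum>Y\<in>strs n E. H n)"
      by (rule sum.cong) (auto simp: strs_def)
    then show ?thesis by (simp add: nstrs_def)
  qed
  then have "sum h (strs n E) \<le> (\<Sum>Y\<in>strs n E. H (length Y))" if "n \<le> k" for n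
    using h that by simp
  then show ?thesis
    unfolding group[of h] group[of "\<lambda>Y. H (length Y)"]
    by (intro sum_mono[where K = "{..k}"] mult_left_mono) auto
qed

text \<open>The expected number of mixed pairs in a uniform string of length \<open>n\<close> and balance \<open>D\<close>.\<close>

definition mixed :: "nat \<Rightarrow> int \<Rightarrow> real" where
  "mixed n D = ((real n)\<^sup>2 - (of_int D)\<^sup>2) / (4 * (real n - 1))"

lemma nstrs_Suc2:
  "nstrs (Suc (Suc n)) D = nstrs n (D - 2) + 2 * nstrs n D + nstrs n (D + 2)"
  by (simp add: nstrs_Suc add.commute)

text \<open>One step of the Doob martingale of the number of mixed pairs, with pairs revealed from
  the front: two ones, one of each in either order, or two zeros. Its increments have size at most
  2, whence the term 4 \<mu>^2. The value \<open>n = 1\<close> is excluded by the denominator n -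
  1.\<close>

lemma mixed_step:
  fixes n :: nat and \<mu> :: real
  assumes n: "n \<noteq> 1" and \<mu>: "0 \<le> \<mu>" "2 * \<mu> \<le> 1"
  shows "nstrs n (D - 2) * exp (- \<mu> * mixed n (D - 2)) + 2 * nstrs n D * exp (- \<mu> * (1 + mixed n D))
           + nstrs n (D + 2) * exp (- \<mu> * mixed n (D + 2))
         \<le> nstrs (Suc (Suc n)) D * exp (4 * \<mu>\<^sup>2 - \<mu> * mixed (Suc (Suc n)) D)"
proof -
  define d where "d = real n"
  define e where "e = real_of_int D"
  define w where "w = nstrs (Suc (Suc n)) D"
  define p where "p = nstrs n (D - 2)"
  define q where "q = 2 * nstrs n D"
  define s where "s = nstrs n (D + 2)"
  define m where "m = mixed (Suc (Suc n)) D"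
  have d: "d = 0 \<or> 2 \<le> d" using n by (auto simp: d_def)
  then have nz: "d - 1 \<noteq> 0" "d + 1 \<noteq> 0" "d\<^sup>2 - 1 \<noteq> 0" "d + 2 > 0" "d + 1 > 0"
    by (auto simp: power2_eq_square) (use mult_mono[of 2 d 2 d] in auto)
  have dd: "d\<^sup>2 - 1 = (d - 1) * (d + 1)" by (simp add: algebra_simps power2_eq_square)
  have Y0: "mixed n (D - 2) - m = (d - e + 2) * (2 - (d - e + 2)) / (2 * (d\<^sup>2 - 1))"
    and Y1: "1 + mixed n D - m = (d + e) * (d - e) / (2 * (d\<^sup>2 - 1))"
    and Y2: "mixed n (D + 2) - m = (d + e + 2) * (2 - (d + e + 2)) / (2 * (d\<^sup>2 - 1))"
    using nz unfolding dd
    by (simp_all add: m_def mixed_def divide_simps flip: d_def e_def) (simp_all add: algebra_simps power2_eq_square)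
  \<comment> \<open>Absorbing twice turns each weight into a polynomial multiple of
    \<open>w\<close>; the centring condition then becomes a polynomial identity.\<close>
  have pw: "4 * (d + 2) * (d + 1) * p = (d + 2 + e) * (d + e) * w"
  proof -
    have "(d + 2 + e) * w = 2 * (d + 2) * nstrs (Suc n) (D - 1)"
      using nstrs_absorb_plus[of "Suc n" D] by (simp add: w_def d_def e_def algebra_simps)
    moreover have "(d + e) * nstrs (Suc n) (D - 1) = 2 * (d + 1) * p"
      using nstrs_absorb_plus[of n "D - 1"] by (simp add: p_def d_def e_def algebra_simps)
    ultimately show ?thesis by algebra
  qed
  have sw: "4 * (d + 2) * (d + 1) * s = (d + 2 - e) * (d - e) * w"
  proof -
    have "(d + 2 - e) * w = 2 * (d + 2) * nstrs (Suc n) (D + 1)"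
      using nstrs_absorb_minus[of "Suc n" D] by (simp add: w_def d_def e_def algebra_simps)
    moreover have "(d - e) * nstrs (Suc n) (D + 1) = 2 * (d + 1) * s"
      using nstrs_absorb_minus[of n "D + 1"] by (simp add: s_def d_def e_def algebra_simps)
    ultimately show ?thesis by algebra
  qed
  have qw: "4 * (d + 2) * (d + 1) * q = 2 * (d + 2 + e) * (d + 2 - e) * w"
  proof -
    have "(d + 2 + e) * w = 2 * (d + 2) * nstrs (Suc n) (D - 1)"
      using nstrs_absorb_plus[of "Suc n" D] by (simp add: w_def d_def e_def algebra_simps)
    moreover have "(d + 2 - e) * nstrs (Suc n) (D - 1) = (d + 1) * q"
      using nstrs_absorb_minus[of n "D - 1"] by (simp add: q_def d_def e_def algebra_simps)
    ultimately show ?thesis by algebra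
  qed
  have "4 * (d + 2) * (d + 1) * (p * (mixed n (D - 2) - m) + q * (1 + mixed n D - m) + s * (mixed n (D + 2) - m))
     = (4 * (d + 2) * (d + 1) * p * ((d - e + 2) * (2 - (d - e + 2))) + 4 * (d + 2) * (d + 1) * q * ((d + e) * (d - e))
         + 4 * (d + 2) * (d + 1) * s * ((d + e + 2) * (2 - (d + e + 2)))) / (2 * (d\<^sup>2 - 1))"
    unfolding Y0 Y1 Y2 by (simp only: add_divide_distrib times_divide_eq_right ring_distribs mult.assoc)
  also have "\<dots> = 0" unfolding pw qw sw by (simp add: algebra_simps)
  finally have centred: "p * (mixed n (D - 2) - m) + q * (1 + mixed n D - m) + s * (mixed n (D + 2) - m) = 0"
    using nz by simp
  have outer: "\<bar>u * (2 - u) / (2 * (d\<^sup>2 - 1))\<bar> \<le> 2" if "0 \<le> u" "u \<le> 2 * d" for u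
  proof (cases "d = 0")
    case False
    with d have d2: "2 \<le> d" by auto
    have "\<bar>u\<bar> * \<bar>2 - u\<bar> \<le> (2 * d) * (2 * d - 2)" using that d2 by (intro mult_mono) auto
    also have "\<dots> \<le> 2 * (2 * (d\<^sup>2 - 1))" using d2 by (simp add: algebra_simps power2_eq_square)
    finally show ?thesis using d2 dd by (simp add: abs_mult abs_divide divide_le_eq)
  qed (use that in auto)
  have inner: "\<bar>(d + e) * (d - e) / (2 * (d\<^sup>2 - 1))\<bar> \<le> 2" if "\<bar>e\<bar> \<le> d"
  proof (cases "d = 0")
    case False
    with d have d2: "2 \<le> d" by auto
    have "4 \<le> d * d" using mult_mono[of 2 d 2 d] d2 by simp
    then have sq: "d * d - e * e \<le> 4 * (d * d) - 4" using zero_le_square[of e] by linarith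
    have "\<bar>d + e\<bar> * \<bar>d - e\<bar> = d\<^sup>2 - e\<^sup>2" using that by (simp add: algebra_simps power2_eq_square)
    also have "\<dots> \<le> 2 * (2 * (d\<^sup>2 - 1))" using sq by (simp add: power2_eq_square)
    finally show ?thesis using d2 dd by (simp add: abs_mult abs_divide divide_le_eq)
  qed (use that in auto)
  have scale: "\<bar>- \<mu> * y\<bar> \<le> 2 * \<mu>" if "\<bar>y\<bar> \<le> 2" for y
    using mult_left_mono[OF that \<mu>(1)] \<mu> by (simp add: abs_mult mult.commute)
  have "p * exp (- \<mu> * (mixed n (D - 2) - m)) + q * exp (- \<mu> * (1 + mixed n D - m))
      + s * exp (- \<mu> * (mixed n (D + 2) - m)) \<le> w * exp ((2 * \<mu>)\<^sup>2)"
  proof (rule exp_mean_le)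
    show "p + q + s = w" by (simp add: p_def q_def s_def w_def nstrs_Suc2)
    have "p * (- \<mu> * (mixed n (D - 2) - m)) + q * (- \<mu> * (1 + mixed n D - m)) + s * (- \<mu> * (mixed n (D + 2) - m))
      = - \<mu> * (p * (mixed n (D - 2) - m) + q * (1 + mixed n D - m) + s * (mixed n (D + 2) - m))"
      by (simp add: algebra_simps)
    then show "p * (- \<mu> * (mixed n (D - 2) - m)) + q * (- \<mu> * (1 + mixed n D - m)) + s * (- \<mu> * (mixed n (D + 2) - m)) = 0"
      unfolding centred by simp
    show "p \<noteq> 0 \<longrightarrow> \<bar>- \<mu> * (mixed n (D - 2) - m)\<bar> \<le> 2 * \<mu>"
    proof
      assume "p \<noteq> 0"
      then have "\<bar>D - 2\<bar> \<le> int n" unfolding p_def by (rule nstrs_pos_imp)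
      then have "\<bar>e - 2\<bar> \<le> d" by (simp add: d_def e_def)
      then show "\<bar>- \<mu> * (mixed n (D - 2) - m)\<bar> \<le> 2 * \<mu>"
        unfolding Y0 by (intro scale outer) auto
    qed
    show "s \<noteq> 0 \<longrightarrow> \<bar>- \<mu> * (mixed n (D + 2) - m)\<bar> \<le> 2 * \<mu>"
    proof
      assume "s \<noteq> 0"
      then have "\<bar>D + 2\<bar> \<le> int n" unfolding s_def by (rule nstrs_pos_imp)
      then have "\<bar>e + 2\<bar> \<le> d" by (simp add: d_def e_def)
      then show "\<bar>- \<mu> * (mixed n (D + 2) - m)\<bar> \<le> 2 * \<mu>"
        unfolding Y2 by (intro scale outer) auto
    qed
    show "q \<noteq> 0 \<longrightarrow> \<bar>- \<mu> * (1 + mixed n D - m)\<bar> \<le> 2 * \<mu>"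
    proof
      assume "q \<noteq> 0"
      then have "\<bar>D\<bar> \<le> int n" unfolding q_def by (intro nstrs_pos_imp) auto
      then have "\<bar>e\<bar> \<le> d" by (simp add: d_def e_def)
      then show "\<bar>- \<mu> * (1 + mixed n D - m)\<bar> \<le> 2 * \<mu>"
        using inner unfolding Y1 by (intro scale) auto
    qed
  qed (use \<mu> in \<open>auto simp: p_def q_def s_def\<close>)
  then have "(p * exp (- \<mu> * (mixed n (D - 2) - m)) + q * exp (- \<mu> * (1 + mixed n D - m))
      + s * exp (- \<mu> * (mixed n (D + 2) - m))) * exp (- \<mu> * m) \<le> w * exp ((2 * \<mu>)\<^sup>2) * exp (- \<mu> * m)"
    by (intro mult_right_mono) auto
  moreover have "exp (- \<mu> * (y - m)) * exp (- \<mu> * m) = exp (- \<mu> * y)" for y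
    by (simp add: algebra_simps flip: exp_add)
  moreover have "exp ((2 * \<mu>)\<^sup>2) * exp (- \<mu> * m) = exp (4 * \<mu>\<^sup>2 - \<mu> * m)"
    by (simp add: algebra_simps power_mult_distrib flip: exp_add)
  ultimately show ?thesis
    by (simp only: p_def q_def s_def w_def m_def ring_distribs(2) mult.assoc)
qed

text \<open>The exponent counts mixed pairs with a negative sign because the lower tail is the
  dangerous one: few mixed pairs leave many survivors and hence many later queries.\<close>

lemma exp_mixed_pairs:
  assumes \<mu>: "0 \<le> \<mu>" "2 * \<mu> \<le> 1"
  shows "(\<Sum>X\<in>strs (2 * k) D. exp (- \<mu> * (real k - length (red X))))
         \<le> nstrs (2 * k) D * exp (4 * \<mu>\<^sup>2 * k - \<mu> * mixed (2 * k) D)"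
proof (induction k arbitrary: D)
  case 0
  show ?case by (auto simp: strs_0 nstrs_def mixed_def)
next
  case (Suc k)
  let ?f = "\<lambda>D. \<Sum>X\<in>strs (2 * k) D. exp (- \<mu> * (real k - length (red X)))"
  let ?e = "exp (4 * \<mu>\<^sup>2 * k)"
  have "2 * Suc k = Suc (Suc (2 * k))" by simp
  then have "(\<Sum>X\<in>strs (2 * Suc k) D. exp (- \<mu> * (real (Suc k) - length (red X))))
      = (\<Sum>X\<in>strs (Suc (Suc (2 * k))) D. exp (- \<mu> * (real (Suc k) - length (red X))))"
    by simp
  also have "\<dots> = ?f (D - 2) + 2 * (exp (- \<mu>) * ?f D) + ?f (D + 2)"
    unfolding sum_strs_Suc by (simp add: sum_distrib_left algebra_simps flip: exp_add)
  also have "\<dots> \<le> nstrs (2 * k) (D - 2) * exp (4 * \<mu>\<^sup>2 * k - \<mu> * mixed (2 * k) (D - 2))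
      + 2 * (exp (- \<mu>) * (nstrs (2 * k) D * exp (4 * \<mu>\<^sup>2 * k - \<mu> * mixed (2 * k) D)))
      + nstrs (2 * k) (D + 2) * exp (4 * \<mu>\<^sup>2 * k - \<mu> * mixed (2 * k) (D + 2))"
    by (intro add_mono mult_left_mono Suc.IH) auto
  also have "\<dots> = ?e * (nstrs (2 * k) (D - 2) * exp (- \<mu> * mixed (2 * k) (D - 2))
      + 2 * nstrs (2 * k) D * exp (- \<mu> * (1 + mixed (2 * k) D))
      + nstrs (2 * k) (D + 2) * exp (- \<mu> * mixed (2 * k) (D + 2)))"
    by (simp add: algebra_simps flip: exp_add)
  also have "\<dots> \<le> ?e * (nstrs (Suc (Suc (2 * k))) D * exp (4 * \<mu>\<^sup>2 - \<mu> * mixed (Suc (Suc (2 * k))) D))"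
    by (intro mult_left_mono mixed_step \<mu>) (presburger, simp)
  also have "\<dots> = nstrs (2 * Suc k) D * exp (4 * \<mu>\<^sup>2 * Suc k - \<mu> * mixed (2 * Suc k) D)"
    by (simp add: algebra_simps flip: exp_add)
  finally show ?case .
qed

text \<open>Since n + |D| \<ge> n - 1. A bound linear in n and |D| is what lets a linear potential
  close the recursion over rounds.\<close>

lemma mixed_ge:
  assumes "n \<ge> 2" "\<bar>D\<bar> \<le> int n"
  shows "mixed n D \<ge> real n / 4 - \<bar>of_int D\<bar> / 4"
proof -
  define d where "d = real n"
  define e where "e = \<bar>real_of_int D\<bar>"
  have de: "2 \<le> d" "0 \<le> e" "e \<le> d" using assms by (auto simp: d_def e_def)
  have "(d - e) * (d - 1) \<le> (d - e) * (d + e)" using de by (intro mult_left_mono) auto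
  also have "\<dots> = d\<^sup>2 - e\<^sup>2" by (simp add: algebra_simps power2_eq_square)
  finally have "d - e \<le> (d\<^sup>2 - e\<^sup>2) / (d - 1)" using de by (simp add: pos_le_divide_eq)
  moreover have "mixed n D = (d\<^sup>2 - e\<^sup>2) / (d - 1) / 4"
    by (simp add: mixed_def d_def e_def mult.commute)
  ultimately have "mixed n D \<ge> (d - e) / 4" by (simp only: divide_right_mono)
  then show ?thesis by (simp add: d_def e_def diff_divide_distrib)
qed

text \<open>The balance halves exactly when an even string is reduced, so the potential
  \<open>(2n + |D|)/3\<close> dominates one level of queries plus its expected value on the next level.\<close>

lemma exp_pair_queries:
  fixes \<nu> :: real
  assumes \<nu>: "0 \<le> \<nu>" "4 * \<nu> \<le> 3"
  shows "(\<Sum>X\<in>strs n D. exp (\<nu> * pair_queries X))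
           \<le> exp (\<nu> * ((2 * real n + \<bar>of_int D\<bar>) / 3) + 2 * \<nu>\<^sup>2 * n) * nstrs n D"
proof (induction n arbitrary: D rule: less_induct)
  case (less n)
  let ?G = "\<lambda>n D. \<nu> * ((2 * real n + \<bar>of_int D\<bar>) / 3) + 2 * \<nu>\<^sup>2 * n"
  consider "n < 2" | "n \<ge> 2" "odd n" | "n \<ge> 2" "even n" by linarith
  then show ?case
  proof cases
    case 1
    have "(\<Sum>X\<in>strs n D. exp (\<nu> * pair_queries X)) = (\<Sum>X\<in>strs n D. 1)"
      using 1 by (intro sum.cong) (auto simp: strs_def pair_queries_short)
    also have "\<dots> = 1 * nstrs n D" by (simp add: nstrs_def)
    also have "\<dots> \<le> exp (?G n D) * nstrs n D" using \<nu> by (intro mult_right_mono) auto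
    finally show ?thesis .
  next
    \<comment> \<open>The last letter stays unpaired. Dropping it moves |D| by at most 1 while 2n
      falls by 2, so the potential does not increase.\<close>
    case 2
    then obtain m where m: "n = Suc m" "even m" by (cases n) auto
    have *: "(\<Sum>X\<in>strs m E. exp (\<nu> * pair_queries (X @ [b]))) = (\<Sum>X\<in>strs m E. exp (\<nu> * pair_queries X))" for E b
      using m by (intro sum.cong) (auto simp: strs_def pair_queries_snoc)
    have G: "(\<Sum>X\<in>strs m E. exp (\<nu> * pair_queries X)) \<le> exp (?G n D) * nstrs m E"
      if "\<bar>E - D\<bar> \<le> 1" for E
    proof -
      have "(\<Sum>X\<in>strs m E. exp (\<nu> * pair_queries X)) \<le> exp (?G m E) * nstrs m E"
        using m by (intro less.IH) auto
      also have "\<dots> \<le> exp (?G n D) * nstrs m E"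
      proof -
        have "\<bar>real_of_int E\<bar> \<le> \<bar>of_int D\<bar> + 1" using that by linarith
        then have "\<nu> * ((2 * real m + \<bar>of_int E\<bar>) / 3) \<le> \<nu> * ((2 * real n + \<bar>of_int D\<bar>) / 3)"
          using m by (intro mult_left_mono \<nu>) auto
        moreover have "2 * \<nu>\<^sup>2 * real m \<le> 2 * \<nu>\<^sup>2 * real n" using m by (intro mult_left_mono) auto
        ultimately show ?thesis by (intro mult_right_mono) auto
      qed
      finally show ?thesis .
    qed
    have "(\<Sum>X\<in>strs n D. exp (\<nu> * pair_queries X))
        = (\<Sum>X\<in>strs m (D - 1). exp (\<nu> * pair_queries X)) + (\<Sum>X\<in>strs m (D + 1). exp (\<nu> * pair_queries X))"
      unfolding m(1) sum_strs_snoc * ..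
    also have "\<dots> \<le> exp (?G n D) * nstrs m (D - 1) + exp (?G n D) * nstrs m (D + 1)"
      by (intro add_mono G) auto
    also have "\<dots> = exp (?G n D) * nstrs n D" by (simp add: m nstrs_Suc algebra_simps)
    finally show ?thesis .
  next
    case 3
    then obtain k where k: "n = 2 * k" by auto
    show ?thesis
    proof (cases "nstrs n D = 0")
      case True
      then have "strs n D = {}" by (simp add: nstrs_def)
      then show ?thesis using True by simp
    next
      case False
      then have absD: "\<bar>D\<bar> \<le> int n" by (rule nstrs_pos_imp)
      obtain X where "X \<in> strs n D" using False by (force simp: nstrs_def)
      then obtain E where E: "D = 2 * E" using 3 bal_red[of X] by (auto simp: strs_def)
      \<comment> \<open>\<open>c\<close> holds what does not depend on the number of survivors: the
        k queries of this round, the halved balance, and the quadratic allowance. Each survivor adds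
        2/3 to the potential, so the mixed pairs are tilted by \<mu> = 2 \<nu> / 3, and 4 \<nu>
        \<le> 3 is exactly 2 \<mu> \<le> 1.\<close>
      define c where "c = \<nu> * (k + \<bar>of_int E\<bar> / 3) + 2 * \<nu>\<^sup>2 * k"
      define H where "H = (\<lambda>j. exp (c + 2 * \<nu> / 3 * real j))"
      have "(\<Sum>X\<in>strs n D. exp (\<nu> * pair_queries X)) = (\<Sum>X\<in>strs n D. exp (\<nu> * k) * exp (\<nu> * pair_queries (red X)))"
        using 3 k by (intro sum.cong)
          (auto simp: strs_def pair_queries_long algebra_simps simp flip: exp_add)
      also have "\<dots> \<le> (\<Sum>X\<in>strs n D. H (length (red X)))"
        unfolding k E
      proof (rule sum_red_le)
        fix j assume j: "j \<le> k"
        have "(\<Sum>Y\<in>strs j E. exp (\<nu> * k) * exp (\<nu> * pair_queries Y)) = exp (\<nu> * k) * (\<Sum>Y\<in>strs j E. exp (\<nu> * pair_queries Y))"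
          by (simp add: sum_distrib_left)
        also have "\<dots> \<le> exp (\<nu> * k) * (exp (?G j E) * nstrs j E)"
          using j k 3 by (intro mult_left_mono less.IH) auto
        also have "\<dots> = exp (\<nu> * k + ?G j E) * nstrs j E" by (simp add: exp_add)
        also have "\<dots> \<le> H j * nstrs j E"
        proof -
          have "2 * \<nu>\<^sup>2 * real j \<le> 2 * \<nu>\<^sup>2 * real k" using j by (intro mult_left_mono) auto
          then show ?thesis by (intro mult_right_mono) (auto simp: H_def c_def field_simps)
        qed
        finally show "(\<Sum>Y\<in>strs j E. exp (\<nu> * k) * exp (\<nu> * pair_queries Y)) \<le> H j * nstrs j E" .
      qed
      also have "\<dots> = exp (c + 2 * \<nu> / 3 * k) * (\<Sum>X\<in>strs (2 * k) D. exp (- (2 * \<nu> / 3) * (real k - length (red X))))"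
        unfolding sum_distrib_left k H_def by (intro sum.cong) (auto simp: field_simps simp flip: exp_add)
      also have "\<dots> \<le> exp (c + 2 * \<nu> / 3 * k) *
          (nstrs (2 * k) D * exp (4 * (2 * \<nu> / 3)\<^sup>2 * k - 2 * \<nu> / 3 * mixed (2 * k) D))"
        using \<nu> by (intro mult_left_mono exp_mixed_pairs) auto
      also have "\<dots> = exp (c + 2 * \<nu> / 3 * k + 4 * (2 * \<nu> / 3)\<^sup>2 * k - 2 * \<nu> / 3 * mixed n D) * nstrs n D"
        by (simp add: k algebra_simps flip: exp_add)
      \<comment> \<open>The linear terms match exactly. The quadratic ones are 2 \<nu>^2 k from
        later rounds and (16/9) \<nu>^2 k from this one, together at most 4 \<nu>^2 k = 2 \<nu>^2
        n.\<close>
      also have "\<dots> \<le> exp (?G n D) * nstrs n D"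
      proof -
        have mx: "2 * \<nu> / 3 * (real n / 4 - \<bar>of_int D\<bar> / 4) \<le> 2 * \<nu> / 3 * mixed n D"
          using \<nu> 3 absD by (intro mult_left_mono mixed_ge) auto
        have n: "real n = 2 * real k" and D: "\<bar>real_of_int D\<bar> = 2 * \<bar>of_int E\<bar>" by (auto simp: k E)
        have sq: "0 \<le> real k * \<nu>\<^sup>2" by simp
        have "c + 2 * \<nu> / 3 * k + 4 * (2 * \<nu> / 3)\<^sup>2 * k - 2 * \<nu> / 3 * mixed n D \<le> ?G n D"
          using mx unfolding c_def n D by (simp add: field_simps) (use sq in linarith)
        then show ?thesis by (intro mult_right_mono) auto
      qed
      finally show ?thesis .
    qed
  qed
qed

section \<open>Repeated pairing on a stack\<close>

text \<open>A block \<open>(c, k)\<close> stands for \<open>2 ^ k\<close> positions of colour \<open>c\<close>; stacks have their top block first.\<close>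

type_synonym block = "bool \<times> nat"

text \<open>Binary increment with carry, except that equal levels of opposite colour annihilate and
  end the carry.\<close>

fun push_block :: "block \<Rightarrow> block list \<Rightarrow> block list" where
  "push_block b [] = [b]"
| "push_block b (c # cs) =
     (if snd b = snd c then (if fst b = fst c then push_block (fst b, Suc (snd b)) cs else cs)
      else b # c # cs)"

fun push_cost :: "block \<Rightarrow> block list \<Rightarrow> nat" where
  "push_cost b [] = 0"
| "push_cost b (c # cs) =
     (if snd b = snd c then Suc (if fst b = fst c then push_cost (fst b, Suc (snd b)) cs else 0) else 0)"

fun run :: "block list \<Rightarrow> bool list \<Rightarrow> block list" where
  "run cs [] = cs"
| "run cs (y # ys) = run (push_block (y, 0) cs) ys"

fun run_cost :: "block list \<Rightarrow> bool list \<Rightarrow> nat" where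
  "run_cost cs [] = 0"
| "run_cost cs (y # ys) = push_cost (y, 0) cs + run_cost (push_block (y, 0) cs) ys"

lemma run_append: "run cs (X @ Y) = run (run cs X) Y"
  by (induction X arbitrary: cs) auto

lemma run_cost_append: "run_cost cs (X @ Y) = run_cost cs X + run_cost (run cs X) Y"
  by (induction X arbitrary: cs) auto

abbreviation up :: "block \<Rightarrow> block" where
  "up b \<equiv> (fst b, Suc (snd b))"

lemma push_block_up: "push_block (up b) (map up cs) = map up (push_block b cs)"
  by (induction b cs rule: push_block.induct) auto

lemma push_cost_up: "push_cost (up b) (map up cs) = push_cost b cs"
  by (induction b cs rule: push_cost.induct) auto

lemma push_block_0_up [simp]: "push_block (x, 0) (map up cs) = (x, 0) # map up cs"
  by (cases cs) auto

lemma push_cost_0_up [simp]: "push_cost (x, 0) (map up cs) = 0"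
  by (cases cs) auto

text \<open>After an even number of letters no block of level 0 is left, so everything on the stack
  was built from survivors, one level up. The k comparisons at level 0 are the queries of the first
  round.\<close>

lemma run_red:
  assumes "length X = 2 * k"
  shows "run [] X = map up (run [] (red X)) \<and> run_cost [] X = k + run_cost [] (red X)"
  using assms
proof (induction k arbitrary: X)
  case (Suc k)
  define Z where "Z = take (2 * k) X"
  have lenZ: "length Z = 2 * k" using Suc.prems by (simp add: Z_def)
  obtain x y where "drop (2 * k) X = [x, y]"
    using Suc.prems by (cases "drop (2 * k) X" rule: remdups_adj.cases)
      (auto dest!: arg_cong[where f = length])
  then have X: "X = Z @ [x, y]" unfolding Z_def by (metis append_take_drop_id)
  have "even (length Z)" using lenZ by simp
  then have red: "red X = red Z @ (if x = y then [x] else [])" unfolding X by (rule red_snoc2)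
  show ?case
    using Suc.IH[OF lenZ] push_block_up[of "(y, 0)" "run [] (red Z)"] push_cost_up[of "(y, 0)" "run [] (red Z)"]
    unfolding red unfolding X by (auto simp: run_append run_cost_append)
qed auto

text \<open>The stack makes its queries depth first, repeated pairing makes them level by level;
  peeling off level 0 with \<open>run_red\<close> identifies the totals.\<close>

lemma run_cost_eq_pair_queries: "run_cost [] X = pair_queries X"
proof (induction X rule: length_induct)
  case (1 X)
  have even: "run_cost [] Z = pair_queries Z" if "even (length Z)" "length Z \<le> length X" for Z
  proof (cases "length Z < 2")
    case True
    then show ?thesis using that by (cases Z) (auto simp: pair_queries_short)
  next
    case False
    have "length (red Z) < length X" using length_red_le[of Z] that False by linarith
    moreover have "length Z = 2 * (length Z div 2)" using that by simp
    ultimately show ?thesis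
      using 1 False run_red[of Z "length Z div 2"] by (simp add: pair_queries_long)
  qed
  show ?case
  proof (cases "even (length X)")
    case False
    then have "X = butlast X @ [last X]" by (cases X) auto
    then obtain Z x where X: "X = Z @ [x]" by metis
    then have "even (length Z)" using False by simp
    moreover from this obtain k where "length Z = 2 * k" by auto
    ultimately show ?thesis
      using even[of Z] run_red[of Z k] by (simp add: X run_cost_append pair_queries_snoc)
  qed (use even in auto)
qed

section \<open>Signed sum, weight and levels of the stack\<close>

fun block_sum :: "block \<Rightarrow> int" where
  "block_sum (c, k) = (if c then 2 ^ k else - (2 ^ k))"

lemma sum_push_block: "(\<Sum>c\<leftarrow>push_block b cs. block_sum c) = block_sum b + (\<Sum>c\<leftarrow>cs. block_sum c)"
proof (induction b cs rule: push_block.induct)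
  case (2 b c cs)
  then show ?case by (cases b; cases c) auto
qed auto

lemma sum_run: "(\<Sum>c\<leftarrow>run cs X. block_sum c) = (\<Sum>c\<leftarrow>cs. block_sum c) + bal X"
  by (induction X arbitrary: cs) (auto simp: sum_push_block)

lemma weight_push_block: "(\<Sum>c\<leftarrow>push_block b cs. 2 ^ snd c) \<le> (2::nat) ^ snd b + (\<Sum>c\<leftarrow>cs. 2 ^ snd c)"
  by (induction b cs rule: push_block.induct) (auto simp: le_Suc_eq)

lemma weight_run: "(\<Sum>c\<leftarrow>run cs X. 2 ^ snd c) \<le> length X + (\<Sum>c\<leftarrow>cs. (2::nat) ^ snd c)"
proof (induction X arbitrary: cs)
  case (Cons x X)
  show ?case using Cons[of "push_block (x, 0) cs"] weight_push_block[of "(x, 0)" cs] by simp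
qed simp

lemma sorted_push_block:
  assumes "sorted_wrt (<) (map snd cs)" "\<forall>c\<in>set cs. snd b \<le> snd c"
  shows "sorted_wrt (<) (map snd (push_block b cs)) \<and> (\<forall>c\<in>set (push_block b cs). snd b \<le> snd c)"
  using assms
proof (induction b cs rule: push_block.induct)
  case (2 b c cs)
  show ?case
  proof (cases "snd b = snd c")
    case True
    show ?thesis
    proof (cases "fst b = fst c")
      case same: True
      have "sorted_wrt (<) (map snd (push_block (fst b, Suc (snd b)) cs)) \<and>
          (\<forall>c\<in>set (push_block (fst b, Suc (snd b)) cs). Suc (snd b) \<le> snd c)"
        using "2.IH"[OF True same, unfolded snd_conv] "2.prems" True by (auto simp: Suc_le_eq)
      then show ?thesis using True same by auto
    qed (use 2 True in auto)
  next
    case False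
    then have "snd b < snd c" using 2 by auto
    then show ?thesis using 2 False by auto
  qed
qed auto

lemma sorted_run: "sorted_wrt (<) (map snd cs) \<Longrightarrow> sorted_wrt (<) (map snd (run cs X))"
proof (induction X arbitrary: cs)
  case (Cons x X)
  then show ?case using sorted_push_block[of cs "(x, 0)"] by simp
qed simp

lemma distinct_run: "distinct (map snd (run [] X))"
  using sorted_run[of "[]" X] strict_sorted_iff by auto

lemma push_block_suffix: "push_block b cs = p @ ds \<Longrightarrow> p = [] \<or> (\<exists>q. cs = q @ ds)"
proof (induction b cs arbitrary: p rule: push_block.induct)
  case (2 b c cs)
  show ?case
  proof (cases "snd b = snd c")
    case True
    show ?thesis
    proof (cases "fst b = fst c")
      case same: True
      then have "p = [] \<or> (\<exists>q. cs = q @ ds)" using 2 True by auto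
      then show ?thesis by (metis append_Cons)
    next
      case False
      then show ?thesis using 2(2) True by (metis append_Cons push_block.simps(2))
    qed
  next
    case False
    then show ?thesis using 2 by (cases p) auto
  qed
qed (auto simp: Cons_eq_append_conv)

text \<open>A push changes only the top of the stack, so any lower part was once all there
  was.\<close>

lemma run_suffix: "run [] X = p @ ds \<Longrightarrow> \<exists>t\<le>length X. run [] (take t X) = ds"
proof (induction X arbitrary: p rule: rev_induct)
  case (snoc x X)
  have "run [] (X @ [x]) = push_block (x, 0) (run [] X)" by (simp add: run_append)
  then consider "p = []" | q where "run [] X = q @ ds" using snoc.prems push_block_suffix by metis
  then show ?case
  proof cases
    case 1
    then show ?thesis using snoc.prems by (intro exI[of _ "Suc (length X)"]) auto
  next
    case 2
    then obtain t where "t \<le> length X" "run [] (take t X) = ds" using snoc.IH by blast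
    then show ?thesis by (intro exI[of _ t]) auto
  qed
qed auto

text \<open>\<open>c # q\<close> and \<open>q\<close> were both entire stacks at some times, and the
  signed sum of a stack is the balance of the letters read.\<close>

lemma block_interval:
  assumes "c \<in> set (run [] X)"
  obtains s t where "s \<le> t" "t \<le> length X" "bal (take t X) - bal (take s X) = block_sum c"
proof -
  obtain p q where "run [] X = p @ c # q" using assms by (meson split_list)
  then obtain t where t: "t \<le> length X" "run [] (take t X) = c # q" using run_suffix by metis
  then obtain s where s: "s \<le> t" "run [] (take s (take t X)) = q" using run_suffix[of "take t X" "[c]" q] by auto
  have "block_sum c + (\<Sum>c\<leftarrow>q. block_sum c) = bal (take t X)" using sum_run[of "[]" "take t X"] t by simp
  moreover have "(\<Sum>c\<leftarrow>q. block_sum c) = bal (take s X)" using sum_run[of "[]" "take s X"] s by (simp add: min_def)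
  ultimately show thesis using that[of s t] s t by simp
qed

lemma sum_powers_le:
  fixes \<beta> :: real
  assumes "distinct ks" "0 \<le> \<beta>" "\<And>k. k \<in> set ks \<Longrightarrow> 2 ^ k \<le> \<beta>"
  shows "(\<Sum>k\<leftarrow>ks. 2 ^ k) \<le> 2 * \<beta>"
proof (cases "ks = []")
  case False
  define M where "M = Max (set ks)"
  have M: "M \<in> set ks" "\<And>k. k \<in> set ks \<Longrightarrow> k \<le> M" using False by (auto simp: M_def)
  have "(\<Sum>k\<leftarrow>ks. 2 ^ k) = (\<Sum>k\<in>set ks. (2::real) ^ k)" using assms(1) by (simp add: sum_list_distinct_conv_sum_set)
  also have "\<dots> \<le> (\<Sum>k<Suc M. (2::real) ^ k)" using M by (intro sum_mono2) (auto simp: less_Suc_eq_le)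
  also have "\<dots> \<le> 2 * 2 ^ M" by (subst geometric_sum) auto
  also have "\<dots> \<le> 2 * \<beta>" using assms(3)[OF M(1)] by simp
  finally show ?thesis .
qed (use assms in simp)

text \<open>Blocks of the minority colour come from intervals whose balance runs against the trend.\<close>

lemma run_weight_le:
  fixes \<sigma> \<beta> :: real
  assumes \<sigma>: "\<bar>\<sigma>\<bar> = 1" and \<beta>: "0 \<le> \<beta>"
    and trend: "\<And>s t. s \<le> t \<Longrightarrow> t \<le> length X \<Longrightarrow> - \<beta> \<le> \<sigma> * (of_int (bal (take t X)) - of_int (bal (take s X)))"
  shows "(\<Sum>c\<leftarrow>run [] X. 2 ^ snd c) \<le> \<sigma> * of_int (bal X) + 4 * \<beta>"
proof -
  define neg where "neg = (\<lambda>c. \<sigma> * of_int (block_sum c) < 0)"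
  have abs_block: "\<bar>\<sigma> * real_of_int (block_sum c)\<bar> = 2 ^ snd c" for c
    using \<sigma> by (cases c) (auto simp: abs_mult)
  \<comment> \<open>Weight is the trend-signed sum plus twice the weight against the trend. The
    latter consists of distinct powers of two, each at most \<beta>, hence is at most 2
    \<beta>.\<close>
  have "(\<Sum>c\<leftarrow>cs. 2 ^ snd c) = \<sigma> * of_int (\<Sum>c\<leftarrow>cs. block_sum c) + 2 * (\<Sum>k\<leftarrow>map snd (filter neg cs). 2 ^ k)" for cs
  proof (induction cs)
    case (Cons c cs)
    have "2 ^ snd c = \<sigma> * of_int (block_sum c) + 2 * (if neg c then 2 ^ snd c else 0)"
      using abs_block[of c] by (auto simp: neg_def)
    then show ?case using Cons by (auto simp: algebra_simps)
  qed simp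
  moreover have "(\<Sum>k\<leftarrow>map snd (filter neg (run [] X)). 2 ^ k) \<le> 2 * \<beta>"
  proof (rule sum_powers_le[OF _ \<beta>])
    show "distinct (map snd (filter neg (run [] X)))" using distinct_run by (rule distinct_map_filter)
    fix k assume "k \<in> set (map snd (filter neg (run [] X)))"
    then obtain c where c: "c \<in> set (run [] X)" "neg c" "k = snd c" by auto
    from c(1) obtain s t where "s \<le> t" "t \<le> length X" "bal (take t X) - bal (take s X) = block_sum c"
      by (rule block_interval)
    then have "- \<beta> \<le> \<sigma> * of_int (block_sum c)" using trend[of s t] by (metis of_int_diff)
    then show "2 ^ k \<le> \<beta>" using abs_block[of c] c by (simp add: neg_def)
  qed
  ultimately show ?thesis using sum_run[of "[]" X] by simp
qed

lemma Suc_square_le_power: "(Suc k)\<^sup>2 \<le> 4 * 2 ^ k"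
proof (induction k)
  case (Suc k)
  show ?case
  proof (cases "k < 2")
    case True
    then show ?thesis by (cases k) (auto simp: power2_eq_square less_Suc_eq)
  next
    case False
    then have "2 * k \<le> k * k" "2 * 2 \<le> k * k" by (intro mult_le_mono; simp)+
    then have "(Suc (Suc k))\<^sup>2 \<le> 2 * (Suc k)\<^sup>2" using False by (simp add: power2_eq_square)
    then show ?thesis using Suc by simp
  qed
qed simp

text \<open>Levels are distinct and the highest is logarithmic in the length. The cruder square root
  is enough, since errors of order sqrt N are allowed anyway.\<close>

lemma length_run_le: "real (length (run [] X)) \<le> 2 * sqrt (length X)"
proof (cases "run [] X = []")
  case False
  define S where "S = set (map snd (run [] X))"
  have card: "card S = length (run [] X)" using distinct_run[of X] unfolding S_def by (metis distinct_card length_map)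
  define M where "M = Max S"
  have S: "finite S" "S \<noteq> {}" using False by (auto simp: S_def)
  have M: "M \<in> S" "S \<subseteq> {..M}" using Max_in[OF S] Max_ge[OF S(1)] by (auto simp: M_def)
  then obtain c where c: "c \<in> set (run [] X)" "M = snd c" by (auto simp: S_def)
  have "2 ^ M \<le> (\<Sum>c\<leftarrow>run [] X. (2::nat) ^ snd c)"
    using c by (intro member_le_sum_list) (auto simp: image_iff)
  also have "\<dots> \<le> length X" using weight_run[of "[]" X] by simp
  finally have "(Suc M)\<^sup>2 \<le> 4 * length X" using Suc_square_le_power[of M] by linarith
  then have "(real (Suc M))\<^sup>2 \<le> 4 * real (length X)" by (metis of_nat_le_iff of_nat_mult of_nat_numeral of_nat_power)
  then have "real (Suc M) \<le> sqrt (4 * real (length X))" by (rule real_le_rsqrt)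
  moreover have "card S \<le> Suc M" using M(2) by (metis card_atMost card_mono finite_atMost)
  ultimately show ?thesis unfolding card[symmetric] by (simp add: real_sqrt_mult)
qed simp

section \<open>Reduction of the algorithm to the stack\<close>

definition constant_on :: "bool list \<Rightarrow> nat list \<Rightarrow> bool" where
  "constant_on X s \<longleftrightarrow> s \<noteq> [] \<and> (\<forall>a\<in>set s. X ! a = X ! hd s)"

definition uniform :: "bool list \<Rightarrow> nat list list \<Rightarrow> bool" where
  "uniform X S \<longleftrightarrow> (\<forall>s\<in>set S. constant_on X s)"

lemma constant_on_not_Nil: "constant_on X s \<Longrightarrow> s \<noteq> []"
  by (simp add: constant_on_def)

definition set_sum :: "bool list \<Rightarrow> nat list list \<Rightarrow> int" where
  "set_sum X S = (\<Sum>s\<leftarrow>S. if X ! hd s then int (length s) else - int (length s))"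

definition total :: "nat list list \<Rightarrow> nat" where
  "total S = (\<Sum>s\<leftarrow>S. length s)"

lemma uniform_append [simp]: "uniform X (S @ S') \<longleftrightarrow> uniform X S \<and> uniform X S'"
  by (auto simp: uniform_def)

lemma set_sum_simps [simp]:
  "set_sum X [] = 0"
  "set_sum X (s # S) = (if X ! hd s then int (length s) else - int (length s)) + set_sum X S"
  "set_sum X (S @ S') = set_sum X S + set_sum X S'"
  by (auto simp: set_sum_def)

lemma total_simps [simp]:
  "total [] = 0" "total (s # S) = length s + total S" "total (S @ S') = total S + total S'"
  by (auto simp: total_def)

lemma abs_set_sum_le: "\<bar>set_sum X S\<bar> \<le> int (total S)"
  by (induction S) auto

text \<open>COMBINE restricted to the two sets it touches, so that the rest of the list can be
  treated by concatenation.\<close>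

definition merge :: "bool list \<Rightarrow> nat list \<Rightarrow> nat list \<Rightarrow> nat list list" where
  "merge X s s' =
     (if X ! hd s = X ! hd s' then [s @ s']
      else if length s > length s' then [drop (length s') s]
      else if length s = length s' then []
      else [drop (length s) s'])"

lemma combine_eq_merge: "combine X (P @ s # s' # R) (Suc (length P)) = P @ merge X s s' @ R"
  by (auto simp: combine_def merge_def nth_append Let_def)

lemma constant_on_drop:
  assumes "constant_on X s" "n < length s"
  shows "constant_on X (drop n s)" "X ! hd (drop n s) = X ! hd s"
proof -
  have "hd (drop n s) \<in> set s" using assms(2) by (metis drop_eq_Nil in_set_dropD leD list.set_sel(1))
  then show hd: "X ! hd (drop n s) = X ! hd s" using assms(1) unfolding constant_on_def by blast
  show "constant_on X (drop n s)"
    using assms unfolding constant_on_def hd by (meson drop_eq_Nil in_set_dropD leD)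
qed

lemma constant_on_append:
  assumes "constant_on X s" "constant_on X s'" "X ! hd s = X ! hd s'"
  shows "constant_on X (s @ s')"
  using assms unfolding constant_on_def by (metis Un_iff append_is_Nil_conv hd_append2 set_append)

lemma merge_properties:
  assumes "uniform X [s, s']"
  shows "uniform X (merge X s s')" "set_sum X (merge X s s') = set_sum X [s, s']" "length (merge X s s') \<le> 1"
proof -
  have c: "constant_on X s" "constant_on X s'" using assms by (auto simp: uniform_def)
  show "uniform X (merge X s s')"
    using c by (auto simp: merge_def uniform_def intro: constant_on_drop constant_on_append)
  show "set_sum X (merge X s s') = set_sum X [s, s']"
    using c by (auto simp: merge_def constant_on_drop of_nat_diff dest: constant_on_not_Nil)
  show "length (merge X s s') \<le> 1" by (simp add: merge_def)
qed

lemma sum_nth_take: "i \<le> length S \<Longrightarrow> (\<Sum>j = 1..i. length (S ! (j - 1))) = total (take i S)"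
proof (induction i)
  case (Suc i)
  then show ?case by (simp add: take_Suc_conv_app_nth)
qed simp

lemma sum_nth_drop:
  assumes "i \<le> length S"
  shows "(\<Sum>j = Suc i..length S. length (S ! (j - 1))) = total (drop i S)"
proof -
  have "(\<Sum>j = 1..length S. length (S ! (j - 1))) = (\<Sum>j = 1..i. length (S ! (j - 1))) + (\<Sum>j = Suc i..length S. length (S ! (j - 1)))"
    using sum.ub_add_nat[of 1 i "\<lambda>j. length (S ! (j - 1))" "length S - i"] assms by simp
  moreover have "total S = total (take i S) + total (drop i S)"
    by (simp flip: total_simps(3))
  ultimately show ?thesis using sum_nth_take[of "length S" S] sum_nth_take[OF assms] by simp
qed

lemma gp_count_unfold:
  "gp_count X S = (if S \<noteq> [] \<and> length (S ! 0) \<le> total (tl S) then Suc (gp_count X (combine X S (pick_i S))) else 0)"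
proof -
  have "(\<Sum>j = 2..length S. length (S ! (j - 1))) = total (tl S)" if "S \<noteq> []"
    using that sum_nth_drop[of 1 S] by (cases S) (auto simp: numeral_2_eq_2)
  then show ?thesis by (subst gp_count.simps) auto
qed

declare gp_count.simps [simp del]

text \<open>What the end phase uses of the selection rule: an index other than 1 never has the
  larger part of the elements at or before it.\<close>

lemma pick_i_cases:
  "pick_i S = 1 \<or> (1 \<le> pick_i S \<and> pick_i S < length S \<and> total (take (pick_i S) S) \<le> total (drop (pick_i S) S))"
proof -
  define Q where "Q = (\<lambda>j. 1 \<le> j \<and> j < length S \<and> s_val S j = s_val S (j + 1))"
  define i where "i = (LEAST j. Q j)"
  have pick: "pick_i S = (if \<exists>j. Q j then
      if (\<Sum>j = 1..i. length (S ! (j - 1))) > (\<Sum>j = i + 1..length S. length (S ! (j - 1))) then 1 else i else 1)"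
    unfolding pick_i_def Let_def Q_def i_def by simp
  show ?thesis
  proof (cases "\<exists>j. Q j")
    case True
    then have "Q i" unfolding i_def by (rule LeastI_ex)
    then have "1 \<le> i" "i < length S" by (auto simp: Q_def)
    then show ?thesis unfolding pick using True sum_nth_take[of i S] sum_nth_drop[of i S] by auto
  qed (simp add: pick)
qed

lemma pick_i_least:
  assumes "1 \<le> i" "i < length S" "s_val S i = s_val S (i + 1)"
    and "\<And>j. 1 \<le> j \<Longrightarrow> j < i \<Longrightarrow> s_val S j \<noteq> s_val S (j + 1)"
    and "total (take i S) \<le> total (drop i S)"
  shows "pick_i S = i"
proof -
  define Q where "Q = (\<lambda>j. 1 \<le> j \<and> j < length S \<and> s_val S j = s_val S (j + 1))"
  have Q: "Q i" using assms by (auto simp: Q_def)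
  have "(LEAST j. Q j) = i"
    using Q assms(4) by (intro Least_equality) (auto simp: Q_def not_less[symmetric])
  moreover have "(\<Sum>j = 1..i. length (S ! (j - 1))) \<le> (\<Sum>j = i + 1..length S. length (S ! (j - 1)))"
    using assms sum_nth_take[of i S] sum_nth_drop[of i S] by auto
  moreover have "\<exists>j. Q j" using Q by auto
  ultimately show ?thesis unfolding pick_i_def Let_def Q_def by (auto simp: not_less)
qed

text \<open>Once the sets in \<open>U\<close> carry the majority of what is left, the reset rule keeps
  the algorithm inside \<open>U\<close>.\<close>

lemma gp_count_endgame:
  assumes "uniform X (U @ R)" "R = [] \<or> \<bar>set_sum X U\<bar> > int (total R)"
  shows "gp_count X (U @ R) \<le> length U"
  using assms
proof (induction "length U" arbitrary: U rule: less_induct)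
  case less
  let ?S = "U @ R" and ?i = "pick_i (U @ R)"
  show ?case
  proof (cases "?S \<noteq> [] \<and> length (?S ! 0) \<le> total (tl ?S)")
    case True
    have "U \<noteq> []" using less.prems True by auto
    moreover have "length U \<noteq> 1"
    proof
      assume "length U = 1"
      then obtain s where U: "U = [s]" by (auto simp: length_Suc_conv)
      then have "s \<noteq> []" using less.prems(1) by (auto simp: uniform_def dest: constant_on_not_Nil)
      then show False using True less.prems(2) by (auto simp: U split: if_splits)
    qed
    ultimately have U2: "1 < length U" by (cases U) auto
    have i: "1 \<le> ?i" "?i < length U"
    proof -
      show "1 \<le> ?i" using pick_i_cases[of ?S] by auto
      \<comment> \<open>Otherwise all of \<open>U\<close>, more than half of the elements, would lie
        at or before the chosen index, and the rule would have reset it to 1.\<close>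
      show "?i < length U"
      proof (rule ccontr)
        assume "\<not> ?i < length U"
        then have i: "length U \<le> ?i" "?i < length ?S" "total (take ?i ?S) \<le> total (drop ?i ?S)"
          using pick_i_cases[of ?S] U2 by auto
        then have "R \<noteq> []" by auto
        then have "\<bar>set_sum X U\<bar> > int (total R)" using less.prems by auto
        then have "total U > total R" using abs_set_sum_le[of X U] by linarith
        moreover have "total U \<le> total (take ?i ?S)" using i by simp
        moreover have "total (drop ?i ?S) \<le> total R"
          using i total_simps(3)[of "take (?i - length U) R" "drop (?i - length U) R"] by simp
        ultimately show False using i by linarith
      qed
    qed
    define P where "P = take (?i - 1) U"
    obtain s s' T where "drop (?i - 1) U = s # s' # T"
      using i by (cases "drop (?i - 1) U" rule: remdups_adj.cases) (auto dest!: arg_cong[where f = length])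
    then have U: "U = P @ s # s' # T" unfolding P_def by (metis append_take_drop_id)
    have iP: "?i = Suc (length P)" using i by (simp add: P_def)
    define U' where "U' = P @ merge X s s' @ T"
    have comb: "combine X ?S ?i = U' @ R"
      unfolding iP unfolding U U'_def using combine_eq_merge[of X P s s' "T @ R"] by simp
    have uni: "uniform X [s, s']" using less.prems(1) by (auto simp: U uniform_def)
    have "length U' < length U" using merge_properties(3)[OF uni] by (simp add: U U'_def)
    moreover have "gp_count X (U' @ R) \<le> length U'"
    proof (rule less.hyps)
      show "uniform X (U' @ R)"
        using less.prems(1) merge_properties(1)[OF uni] by (auto simp: U U'_def uniform_def)
      show "R = [] \<or> \<bar>set_sum X U'\<bar> > int (total R)"
      proof -
        have "set_sum X U' = set_sum X U" using merge_properties(2)[OF uni] by (simp add: U U'_def)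
        then show ?thesis using less.prems(2) by simp
      qed
    qed fact
    moreover have "gp_count X ?S = Suc (gp_count X (U' @ R))"
      using gp_count_unfold[of X ?S] unfolding if_P[OF True] comb .
    ultimately show ?thesis by linarith
  next
    case False
    have "gp_count X ?S = 0" using gp_count_unfold[of X ?S] unfolding if_not_P[OF False] .
    then show ?thesis by simp
  qed
qed

section \<open>Lists of sets read as lists of blocks\<close>

definition shape :: "bool list \<Rightarrow> nat list list \<Rightarrow> (bool \<times> nat) list" where
  "shape X S = map (\<lambda>s. (X ! hd s, length s)) S"

definition expand :: "block list \<Rightarrow> (bool \<times> nat) list" where
  "expand cs = map (\<lambda>(c, k). (c, 2 ^ k)) cs"

lemma expand_simps [simp]:
  "expand [] = []" "expand (c # cs) = (fst c, 2 ^ snd c) # expand cs" "expand (cs @ ds) = expand cs @ expand ds"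
  "length (expand cs) = length cs"
  by (auto simp: expand_def split: prod.splits)

lemma length_eq_of_shape: "shape X S = sh \<Longrightarrow> length S = length sh"
  by (auto simp: shape_def)

lemma shape_take: "shape X (take m S) = take m (shape X S)"
  and shape_drop: "shape X (drop m S) = drop m (shape X S)"
  by (simp_all add: shape_def take_map drop_map)

lemma take_expand: "take m (expand cs) = expand (take m cs)"
  and drop_expand: "drop m (expand cs) = expand (drop m cs)"
  by (simp_all add: expand_def take_map drop_map)

lemma total_shape: "total S = (\<Sum>x\<leftarrow>shape X S. snd x)"
  by (induction S) (auto simp: shape_def)

lemma set_sum_shape: "set_sum X S = (\<Sum>x\<leftarrow>shape X S. if fst x then int (snd x) else - int (snd x))"
  by (induction S) (auto simp: shape_def)

lemma sum_expand_block: "(\<Sum>x\<leftarrow>expand cs. if fst x then int (snd x) else - int (snd x)) = (\<Sum>c\<leftarrow>cs. block_sum c)"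
  by (induction cs) auto

lemma sum_expand_weight: "(\<Sum>x\<leftarrow>expand cs. snd x) = (\<Sum>c\<leftarrow>cs. 2 ^ snd c)"
  by (induction cs) auto

abbreviation singles :: "bool list \<Rightarrow> block list" where
  "singles ys \<equiv> map (\<lambda>y. (y, 0)) ys"

lemma sum_singles: "(\<Sum>c\<leftarrow>singles ys. block_sum c) = bal ys" "(\<Sum>c\<leftarrow>singles ys. (2::nat) ^ snd c) = length ys"
  by (induction ys) auto

text \<open>On powers of two the 2-adic valuation prescribed for the first set agrees with the
  logarithm prescribed for the others.\<close>

lemma s_val_shape:
  assumes "shape X S = expand cs" "1 \<le> j" "j \<le> length cs"
  shows "s_val S j = snd (cs ! (j - 1))"
proof -
  have "length S = length cs" using assms(1) by (metis expand_simps(4) length_eq_of_shape)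
  then have "length (S ! (j - 1)) = snd (expand cs ! (j - 1))"
    using assms by (simp flip: assms(1) add: shape_def)
  then have len: "length (S ! (j - 1)) = 2 ^ snd (cs ! (j - 1))"
    using assms by (simp add: expand_def split: prod.splits)
  have "(GREATEST t. (2::nat) ^ t dvd 2 ^ k) = k" for k
    by (rule Greatest_equality) (auto simp: dvd_power_iff_le)
  then show ?thesis using len by (auto simp: s_val_def)
qed

text \<open>Deterministic comparison. A reset needs a stack heavier than the unread letters, and
  \<open>early\<close> allows this only from K letters before \<open>t0\<close> onwards. Until then
  the queries are those of the stack; afterwards the end phase makes at most one query per remaining
  set up to \<open>t0\<close>, which \<open>short\<close> bounds by L blocks and K letters.\<close>

lemma C_GP_le:
  fixes X :: "bool list" and t0 K L :: nat
  assumes X: "X \<noteq> []" and t0: "t0 \<le> length X"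
    and decided: "t0 = length X \<or> \<bar>bal (take t0 X)\<bar> > int (length X - t0)"
    and early: "\<And>s t. s \<le> t \<Longrightarrow> t \<le> length X \<Longrightarrow>
      (\<Sum>c\<leftarrow>run [] (take s X). 2 ^ snd c) > length X - t \<Longrightarrow> t0 \<le> t + K"
    and short: "\<And>t. t \<le> length X \<Longrightarrow> length (run [] (take t X)) < L"
  shows "C_GP X \<le> run_cost [] (take t0 X) + K + L"
proof -
  define N where "N = length X"
  (* b is about to be pushed onto cs; cs is the stack of an earlier prefix, so "early" applies to it *)
  have main: "gp_count X S \<le> push_cost b cs + run_cost (push_block b cs) (take (t0 - t) ys) + K + L"
    if "uniform X S" "shape X S = expand (rev cs @ b # singles ys)" "t \<le> N" "ys = drop t X"
      "push_block b cs = run [] (take t X)" "s \<le> t" "cs = run [] (take s X)"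
      "sorted_wrt (<) (map snd cs)" "\<forall>c\<in>set cs. snd b \<le> snd c" for S b cs ys s t
    using that
  \<comment> \<open>A carry shortens \<open>cs\<close>. A settled block lengthens it by one but
    consumes a letter, which therefore counts twice.\<close>
  proof (induction "length cs + 2 * length ys" arbitrary: S b cs ys s t rule: less_induct)
    case less
    note uni = less.prems(1) and shape = less.prems(2) and t = less.prems(3) and ys = less.prems(4)
      and push = less.prems(5) and s = less.prems(6) and cs = less.prems(7)
      and sorted = less.prems(8) and low = less.prems(9)
    have lenys: "length ys = N - t" using ys by (simp add: N_def)
    have lenS: "length S = length cs + 1 + length ys" using length_eq_of_shape[OF shape] by simp
    show ?case
    proof (cases "t0 \<le> t + K")
      case True
      \<comment> \<open>The end phase takes over on the stack, the pending block and the letters up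
        to \<open>t0\<close>. Truncated subtraction covers a \<open>t\<close> already past
        \<open>t0\<close>.\<close>
      define m where "m = length cs + 1 + (t0 - t)"
      have shapeU: "shape X (take m S) = expand (rev cs @ b # singles (take (t0 - t) ys))"
        and shapeR: "shape X (drop m S) = expand (singles (drop (t0 - t) ys))"
        unfolding shape_take shape_drop shape take_expand drop_expand
        by (simp_all add: m_def take_map drop_map)
      have total: "total (drop m S) = N - t - (t0 - t)"
        unfolding total_shape[of _ X] shapeR sum_expand_weight sum_singles by (simp add: lenys)
      have "block_sum b + (\<Sum>c\<leftarrow>cs. block_sum c) = bal (take t X)"
        using sum_push_block[of b cs] sum_run[of "[]" "take t X"] push by simp
      then have "set_sum X (take m S) = bal (take t X) + bal (take (t0 - t) ys)"
        unfolding set_sum_shape shapeU sum_expand_block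
        by (simp only: map_append list.map sum_list.append sum_list.Cons sum_singles rev_map[symmetric] sum_list_rev)
      also have "\<dots> = bal (take (t + (t0 - t)) X)" by (simp add: take_add ys)
      finally have sum: "set_sum X (take m S) = bal (take (t + (t0 - t)) X)" .
      have "drop m S = [] \<or> \<bar>set_sum X (take m S)\<bar> > int (total (drop m S))"
      proof (cases "t0 = length X")
        case True
        then show ?thesis using lenS lenys by (simp add: m_def N_def)
      next
        case False
        then have maj: "\<bar>bal (take t0 X)\<bar> > int (N - t0)" using decided by (simp add: N_def)
        \<comment> \<open>Past \<open>t0\<close> each letter moves the balance by at most 1 and also
          shortens the remainder by 1, so the majority persists.\<close>
        have "take (t + (t0 - t)) X = take t0 X @ take (t - t0) (drop t0 X)"
        proof -
          have "t + (t0 - t) = t0 + (t - t0)" by simp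
          then show ?thesis by (simp only: take_add)
        qed
        moreover have "\<bar>bal (take (t - t0) (drop t0 X))\<bar> \<le> int (t - t0)"
          by (rule order_trans[OF abs_bal_le]) simp
        ultimately have "\<bar>bal (take t0 X)\<bar> \<le> \<bar>bal (take (t + (t0 - t)) X)\<bar> + int (t - t0)"
          by simp
        moreover have "int (N - t - (t0 - t)) + int (t - t0) = int (N - t0)"
          using t t0 unfolding N_def by linarith
        ultimately have "\<bar>bal (take (t + (t0 - t)) X)\<bar> > int (N - t - (t0 - t))"
          using maj by linarith
        then show ?thesis by (simp add: sum total)
      qed
      then have "gp_count X (take m S @ drop m S) \<le> length (take m S)"
        using uni by (intro gp_count_endgame) auto
      then have "gp_count X S \<le> m" by simp
      moreover have "length cs < L" using short[of s] s t cs by (simp add: N_def)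
      ultimately show ?thesis using True by (simp add: m_def)
    next
      case False
      then have "t < N" using t0 by (simp add: N_def)
      then obtain y ys' where ys': "ys = y # ys'" "ys' = drop (Suc t) X"
        using ys by (metis Cons_nth_drop_Suc N_def)
      have takeSuc: "take (Suc t) X = take t X @ [y]"
        using ys ys' by (metis Cons_nth_drop_Suc N_def \<open>t < N\<close> list.inject take_Suc_conv_app_nth)
      have step: "t0 - t = Suc (t0 - Suc t)" using False by linarith
      \<comment> \<open>Here \<open>t\<close> is more than K letters before \<open>t0\<close>, so
        \<open>early\<close> is used contrapositively; this inequality keeps the reset rule from
        firing.\<close>
      have light: "(\<Sum>c\<leftarrow>cs. 2 ^ snd c) \<le> length ys"
        using early[of s t] s t False cs lenys by (simp add: N_def not_less[symmetric]) (meson not_le_imp_less)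
      have next_push: "push_block (y, 0) (push_block b cs) = run [] (take (Suc t) X)"
        by (simp add: takeSuc run_append push)
      consider (eq) c cs' where "cs = c # cs'" "snd c = snd b" | (settle) "cs = [] \<or> snd b \<noteq> snd (hd cs)"
        by (metis list.exhaust_sel)
      then show ?thesis
      proof cases
        \<comment> \<open>No query is made: the block joins the stack and the next letter becomes
          the pending block.\<close>
        case settle
        have "push_block b cs = b # cs \<and> push_cost b cs = 0"
          by (cases cs) (use settle in auto)
        then have nopush: "push_block b cs = b # cs" "push_cost b cs = 0" by auto
        have "sorted_wrt (<) (map snd (b # cs))"
        proof (cases cs)
          case (Cons c cs')
          then have "snd b < snd c" using low settle by fastforce
          then show ?thesis using sorted Cons by auto
        qed simp
        moreover have "shape X S = expand (rev (b # cs) @ (y, 0) # singles ys')"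
          using shape by (simp add: ys'(1))
        moreover have "length (b # cs) + 2 * length ys' < length cs + 2 * length ys" by (simp add: ys'(1))
        moreover have "push_block (y, 0) (b # cs) = run [] (take (Suc t) X)" using next_push nopush by simp
        moreover have "b # cs = run [] (take t X)" using push nopush by simp
        ultimately have "gp_count X S \<le> push_cost (y, 0) (b # cs)
            + run_cost (push_block (y, 0) (b # cs)) (take (t0 - Suc t) ys') + K + L"
          using uni \<open>t < N\<close> by (intro less.hyps[where s = t]) (rule ys'(2) | simp)+
        then show ?thesis by (simp add: nopush ys'(1) step)
      next
        case eq
        define p where "p = length cs'"
        have lenS': "p + 2 \<le> length S" using lenS eq by (simp add: p_def)
        define P where "P = take p S"
        define R where "R = drop (p + 2) S"
        define u where "u = S ! p"
        define u' where "u' = S ! Suc p"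
        have lenP: "length P = p" using lenS' by (simp add: P_def)
        have S: "S = P @ u # u' # R"
          using lenS' by (simp add: P_def R_def u_def u'_def Cons_nth_drop_Suc)
        have "shape X P @ [(X ! hd u, length u), (X ! hd u', length u')] @ shape X R
            = expand (rev cs') @ [(fst c, 2 ^ snd b), (fst b, 2 ^ snd b)] @ expand (singles ys)"
          using shape eq by (simp add: S shape_def)
        then have shapes: "shape X P = expand (rev cs')" "X ! hd u = fst c" "length u = 2 ^ snd b"
          "X ! hd u' = fst b" "length u' = 2 ^ snd b" "shape X R = expand (singles ys)"
          using lenP by (auto simp: append_eq_append_conv shape_def p_def)
        have uni': "uniform X P" "uniform X [u, u']" "uniform X R" using uni by (auto simp: S uniform_def)
        show ?thesis
        proof (cases "S \<noteq> [] \<and> length (S ! 0) \<le> total (tl S)")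
          case True
          \<comment> \<open>Levels strictly decrease along the stacked part of the list, so the
            first equal neighbours are the top block \<open>c\<close> and the pending block
            \<open>b\<close>.\<close>
          have pick: "pick_i S = Suc p"
          proof (rule pick_i_least)
            show "Suc p < length S" using lenS' by simp
            have sv: "s_val S j = snd ((rev cs @ b # singles ys) ! (j - 1))" if "1 \<le> j" "j \<le> Suc (Suc p)" for j
              using that lenS' by (intro s_val_shape[OF shape]) (auto simp: eq p_def)
            have p_cs: "length cs = Suc p" by (simp add: eq p_def)
            show "s_val S (Suc p) = s_val S (Suc p + 1)"
              by (simp add: sv p_cs nth_append rev_nth eq flip: p_def)
            show "s_val S j \<noteq> s_val S (j + 1)" if j: "1 \<le> j" "j < Suc p" for j
            proof
              assume same: "s_val S j = s_val S (j + 1)"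
              obtain i where i: "j = Suc i" using j by (cases j) auto
              have "s_val S j = snd (rev cs ! i)" "s_val S (j + 1) = snd (rev cs ! Suc i)"
                using j sv[of j] sv[of "j + 1"] p_cs by (simp_all add: nth_append i)
              then have "map snd (rev cs) ! i = map snd (rev cs) ! Suc i"
                using same j p_cs by (simp add: i)
              moreover have "distinct (map snd cs)" using sorted by (simp add: strict_sorted_iff)
              then have "distinct (map snd (rev cs))" by (simp only: rev_map[symmetric] distinct_rev)
              moreover have "i < length (map snd (rev cs))" "Suc i < length (map snd (rev cs))"
                using j p_cs i by simp_all
              ultimately have "i = Suc i" using nth_eq_iff_index_eq by blast
              then show False by simp
            qed
            have "total (take (Suc p) S) = (\<Sum>c\<leftarrow>rev cs. 2 ^ snd c)"
            proof -
              have "shape X (take (Suc p) S) = expand (rev cs)"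
                using arg_cong[OF shape, of "take (Suc p)"] p_cs by (simp add: shape_def take_map)
              then show ?thesis by (simp only: total_shape[of _ X] sum_expand_weight)
            qed
            also have "\<dots> = (\<Sum>c\<leftarrow>cs. 2 ^ snd c)" by (simp flip: rev_map add: sum_list_rev)
            also have "\<dots> \<le> length ys" by (rule light)
            also have "\<dots> = total R" by (simp only: total_shape[of _ X] shapes sum_expand_weight sum_singles)
            also have "\<dots> \<le> total (drop (Suc p) S)" by (simp add: S lenP)
            finally show "total (take (Suc p) S) \<le> total (drop (Suc p) S)" .
          qed simp
          have comb: "combine X S (pick_i S) = P @ merge X u u' @ R"
            unfolding pick unfolding S lenP[symmetric] by (rule combine_eq_merge)
          have gp: "gp_count X S = Suc (gp_count X (P @ merge X u u' @ R))"
            using gp_count_unfold[of X S] unfolding if_P[OF True] comb .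
          have uniM: "uniform X (P @ merge X u u' @ R)"
            using uni' merge_properties(1)[OF uni'(2)] by simp
          have sorted': "sorted_wrt (<) (map snd cs')" "\<forall>d\<in>set cs'. snd b < snd d"
            using sorted eq by auto
          \<comment> \<open>The part below \<open>c\<close> is the whole stack of an earlier prefix,
            which restores the invariant after the top is consumed.\<close>
          obtain s' where s': "s' \<le> s" "run [] (take s' X) = cs'"
            using run_suffix[of "take s X" "[c]" cs'] cs eq by (auto simp: min_def split: if_splits)
          show ?thesis
          proof (cases "fst b = fst c")
            case same: True
            have "gp_count X (P @ merge X u u' @ R) \<le> push_cost (up b) cs'
                + run_cost (push_block (up b) cs') (take (t0 - t) ys) + K + L"
            proof (rule less.hyps[where s = s'])
              show "shape X (P @ merge X u u' @ R) = expand (rev cs' @ up b # singles ys)"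
                using shapes same uni' by (auto simp: shape_def merge_def uniform_def dest: constant_on_not_Nil)
              show "length cs' + 2 * length ys < length cs + 2 * length ys" by (simp add: eq)
              show "push_block (up b) cs' = run [] (take t X)" using push same by (simp add: eq)
              show "s' \<le> t" using s s' by simp
              show "cs' = run [] (take s' X)" using s' by simp
              show "\<forall>d\<in>set cs'. snd (up b) \<le> snd d" using sorted' by (simp add: Suc_le_eq)
            qed fact+
            then show ?thesis using same eq by (simp add: gp)
          next
            case diff: False
            have "gp_count X (P @ merge X u u' @ R) \<le> push_cost (y, 0) cs'
                + run_cost (push_block (y, 0) cs') (take (t0 - Suc t) ys') + K + L"
            proof (rule less.hyps[where s = s'])
              show "shape X (P @ merge X u u' @ R) = expand (rev cs' @ (y, 0) # singles ys')"
                using shapes diff by (simp add: shape_def merge_def ys'(1))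
              show "length cs' + 2 * length ys' < length cs + 2 * length ys" by (simp add: eq ys'(1))
              show "push_block (y, 0) cs' = run [] (take (Suc t) X)" using next_push diff by (simp add: eq)
              show "Suc t \<le> N" using \<open>t < N\<close> by simp
              show "s' \<le> Suc t" using s s' by simp
              show "cs' = run [] (take s' X)" using s' by simp
              show "ys' = drop (Suc t) X" by (rule ys'(2))
            qed (use uniM sorted' in simp_all)
            then show ?thesis using diff eq by (simp add: gp ys'(1) step)
          qed
        next
          case False
          have "gp_count X S = 0" using gp_count_unfold[of X S] unfolding if_not_P[OF False] .
          then show ?thesis by simp
        qed
      qed
    qed
  qed
  obtain x Y where XY: "X = x # Y" using X by (cases X) auto
  define S where "S = map (\<lambda>k. [k]) [0..<length X]"
  have uni: "uniform X S" by (simp add: uniform_def constant_on_def S_def)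
  have "shape X S = map (\<lambda>x. (x, 1)) (map ((!) X) [0..<length X])"
    by (simp add: shape_def S_def comp_def)
  also have "\<dots> = expand (rev [] @ (x, 0) # singles Y)"
    by (simp only: map_nth) (simp add: XY expand_def comp_def)
  finally have shape: "shape X S = expand (rev [] @ (x, 0) # singles Y)" .
  have "C_GP X = gp_count X S" by (simp add: C_GP_def S_def)
  also have "\<dots> \<le> push_cost (x, 0) [] + run_cost (push_block (x, 0) []) (take (t0 - 1) Y) + K + L"
    by (rule main[where s = 0 and t = 1, OF uni shape]) (simp_all add: N_def XY)
  also have "\<dots> \<le> run_cost [] (take t0 X) + K + L"
  proof (cases t0)
    case 0
    then show ?thesis by (simp add: XY)
  qed (simp add: XY)
  finally show ?thesis .
qed

section \<open>The tail bound\<close>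

lemma C_GP_le_length: "C_GP X \<le> length X"
  using gp_count_endgame[of X "map (\<lambda>k. [k]) [0..<length X]" "[]"]
  by (simp add: C_GP_def uniform_def constant_on_def)

text \<open>The potential of the actual prefix balance is subtracted inside the exponent. The moment
  bound is then the same for every balance, and one Markov inequality serves all of them.\<close>

lemma markov_pair_queries:
  fixes \<nu> \<gamma> :: real
  assumes \<nu>: "0 \<le> \<nu>" "4 * \<nu> \<le> 3" and T: "T \<le> N"
  shows "real (card {X \<in> strs N D. (2 * real T + \<bar>of_int (bal (take T X))\<bar>) / 3 + \<gamma> \<le> pair_queries (take T X)})
           \<le> nstrs N D * exp (2 * \<nu>\<^sup>2 * T - \<nu> * \<gamma>)"
proof -
  define g where "g = (\<lambda>E::int. (2 * real T + \<bar>of_int E\<bar>) / 3)"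
  define f where "f = (\<lambda>Y. exp (\<nu> * (real (pair_queries Y) - g (bal Y))))"
  have "sum f (strs T E) \<le> exp (2 * \<nu>\<^sup>2 * T) * nstrs T E" for E
  proof -
    have "sum f (strs T E) = exp (- \<nu> * g E) * (\<Sum>Y\<in>strs T E. exp (\<nu> * pair_queries Y))"
      unfolding sum_distrib_left f_def by (intro sum.cong) (auto simp: strs_def algebra_simps simp flip: exp_add)
    also have "\<dots> \<le> exp (- \<nu> * g E) * (exp (\<nu> * g E + 2 * \<nu>\<^sup>2 * T) * nstrs T E)"
      unfolding g_def by (intro mult_left_mono exp_pair_queries \<nu>) auto
    also have "\<dots> = exp (2 * \<nu>\<^sup>2 * T) * nstrs T E"
      by (simp flip: exp_add mult.assoc)
    finally show ?thesis .
  qed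
  from sum_take_le[of f, OF this, of "N - T" D]
  have sum: "(\<Sum>X\<in>strs N D. f (take T X)) \<le> exp (2 * \<nu>\<^sup>2 * T) * nstrs N D" using T by simp
  let ?B = "{X \<in> strs N D. g (bal (take T X)) + \<gamma> \<le> pair_queries (take T X)}"
  have "real (card ?B) * exp (\<nu> * \<gamma>) = (\<Sum>X\<in>?B. exp (\<nu> * \<gamma>))" by simp
  also have "\<dots> \<le> (\<Sum>X\<in>?B. f (take T X))"
    unfolding f_def using \<nu> by (intro sum_mono) (auto intro!: mult_left_mono)
  also have "\<dots> \<le> (\<Sum>X\<in>strs N D. f (take T X))" by (intro sum_mono2) (auto simp: f_def)
  also note sum
  finally have "real (card ?B) * exp (\<nu> * \<gamma>) * exp (- (\<nu> * \<gamma>)) \<le> exp (2 * \<nu>\<^sup>2 * T) * nstrs N D * exp (- (\<nu> * \<gamma>))"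
    by (intro mult_right_mono) auto
  then show ?thesis by (simp add: g_def exp_diff exp_minus field_simps)
qed

text \<open>The prefix length by which the majority colour is decided unless the balance fluctuates by \<open>\<beta>\<close>.\<close>

definition decision_time :: "nat \<Rightarrow> int \<Rightarrow> real \<Rightarrow> nat" where
  "decision_time N D \<beta> = min N (nat \<lfloor>(N + \<beta>) / (1 + \<bar>of_int D\<bar> / N)\<rfloor> + 1)"

text \<open>In 11 \<beta> + 4, the window K contributes 10 \<beta> + 2, rounding in L gives 1,
  rounding in T gives 1, and the last \<beta> is 2/3 \<beta> from the size of T plus 1/3 \<beta>
  from the prefix balance.\<close>

lemma C_GP_typical:
  fixes N :: nat and D :: int and \<beta> \<gamma> :: real
  defines "T \<equiv> decision_time N D \<beta>"
  assumes N: "0 < N" and X: "X \<in> strs N D" and \<beta>: "0 \<le> \<beta>"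
    and dev: "\<And>s. s \<le> N \<Longrightarrow> \<bar>of_int (bal (take s X)) - s * (of_int D / N)\<bar> < \<beta>"
    and queries: "pair_queries (take T X) < (2 * real T + \<bar>of_int (bal (take T X))\<bar>) / 3 + \<gamma>"
  shows "real (C_GP X) < 2 / 3 * N - \<bar>of_int D\<bar> / 6 + \<gamma> + 11 * \<beta> + 2 * sqrt N + 4"
proof -
  define \<sigma> :: real where "\<sigma> = (if D \<ge> 0 then 1 else - 1)"
  define \<epsilon> where "\<epsilon> = \<bar>real_of_int D\<bar> / N"
  have len: "length X = N" and D: "D = bal X" using X by (auto simp: strs_def)
  have \<sigma>: "\<bar>\<sigma>\<bar> = 1" by (simp add: \<sigma>_def)
  have "\<bar>D\<bar> \<le> int N" using abs_bal_le[of X] len D by simp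
  then have \<epsilon>: "0 \<le> \<epsilon>" "\<epsilon> \<le> 1" using N by (auto simp: \<epsilon>_def)
  have N\<epsilon>: "N * \<epsilon> = \<bar>of_int D\<bar>" using N by (simp add: \<epsilon>_def)
  have \<sigma>D: "\<sigma> * (of_int D / N) = \<epsilon>" by (simp add: \<sigma>_def \<epsilon>_def)
  have dev\<sigma>: "\<bar>\<sigma> * of_int (bal (take s X)) - s * \<epsilon>\<bar> < \<beta>" if "s \<le> N" for s
  proof -
    have "\<sigma> * of_int (bal (take s X)) - s * \<epsilon> = \<sigma> * (of_int (bal (take s X)) - s * (of_int D / N))"
      unfolding \<sigma>D[symmetric] by (simp add: algebra_simps)
    then show ?thesis using dev[OF that] \<sigma> by (simp add: abs_mult)
  qed
  have T: "T \<le> N" "real T \<le> (N + \<beta>) / (1 + \<epsilon>) + 1"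
  proof -
    show "T \<le> N" by (simp add: T_def decision_time_def)
    have "0 \<le> (N + \<beta>) / (1 + \<epsilon>)" using \<beta> \<epsilon> by simp
    then show "real T \<le> (N + \<beta>) / (1 + \<epsilon>) + 1"
      unfolding T_def decision_time_def \<epsilon>_def by linarith
  qed
  have Tlarge: "N + \<beta> < T * (1 + \<epsilon>)" if "T \<noteq> N"
  proof -
    have "(N + \<beta>) / (1 + \<epsilon>) < T" using that unfolding T_def decision_time_def \<epsilon>_def by linarith
    then show ?thesis using \<epsilon> by (simp add: pos_divide_less_eq)
  qed
  \<comment> \<open>A heavy stack means N - t < t \<epsilon> + 9 \<beta>: one \<beta> for the
    deviation of the prefix and 4 (2 \<beta>) for blocks against the trend. So N + \<beta> < (t + 10
    \<beta>)(1 + \<epsilon>), and the extra 1 is the rounding in T.\<close>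
  define K where "K = nat \<lceil>10 * \<beta> + 1\<rceil>"
  define L where "L = nat \<lfloor>2 * sqrt N\<rfloor> + 1"
  have "C_GP X \<le> run_cost [] (take T X) + K + L"
  proof (rule C_GP_le)
    show "X \<noteq> []" "T \<le> length X" using N T len by auto
    show "T = length X \<or> \<bar>bal (take T X)\<bar> > int (length X - T)"
    proof (cases "T = N")
      case False
      have "real T * \<epsilon> - \<beta> < \<sigma> * of_int (bal (take T X))" using dev\<sigma>[OF T(1)] by linarith
      also have "\<dots> \<le> \<bar>of_int (bal (take T X))\<bar>" using \<sigma> by (metis abs_ge_self abs_mult mult_1)
      finally have "real N - T < \<bar>of_int (bal (take T X))\<bar>" using Tlarge[OF False] by (simp add: algebra_simps)
      then have "real_of_int (int (N - T)) < of_int \<bar>bal (take T X)\<bar>" using T by (simp add: of_nat_diff)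
      then show ?thesis by (simp add: len) linarith
    qed (simp add: len)
    show "length (run [] (take t X)) < L" if "t \<le> length X" for t
    proof -
      have "real (length (run [] (take t X))) \<le> 2 * sqrt (length (take t X))" by (rule length_run_le)
      also have "\<dots> \<le> 2 * sqrt N" by (simp add: len)
      finally show ?thesis unfolding L_def by linarith
    qed
    show "T \<le> t + K" if st: "s \<le> t" "t \<le> length X"
      and heavy: "(\<Sum>c\<leftarrow>run [] (take s X). 2 ^ snd c) > length X - t" for s t
    proof -
      have "(\<Sum>c\<leftarrow>run [] (take s X). (2::real) ^ snd c) \<le> \<sigma> * of_int (bal (take s X)) + 4 * (2 * \<beta>)"
      proof (rule run_weight_le[OF \<sigma>])
        fix a b assume ab: "a \<le> b" "b \<le> length (take s X)"
        then have "take b (take s X) = take b X" "take a (take s X) = take a X" "b \<le> N" using st len by auto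
        moreover have "real a * \<epsilon> \<le> b * \<epsilon>" using ab \<epsilon> by (intro mult_right_mono) auto
        moreover have "\<bar>\<sigma> * of_int (bal (take b X)) - b * \<epsilon>\<bar> < \<beta>" "\<bar>\<sigma> * of_int (bal (take a X)) - a * \<epsilon>\<bar> < \<beta>"
          using dev\<sigma> ab \<open>b \<le> N\<close> by auto
        ultimately show "- (2 * \<beta>) \<le> \<sigma> * (of_int (bal (take b (take s X))) - of_int (bal (take a (take s X))))"
          unfolding right_diff_distrib by simp
      qed (use \<beta> in simp)
      also have "\<dots> \<le> s * \<epsilon> + 9 * \<beta>" using dev\<sigma>[of s] st len by simp
      also have "\<dots> \<le> t * \<epsilon> + 9 * \<beta>" using st \<epsilon> by (simp add: mult_right_mono)
      finally have "(\<Sum>c\<leftarrow>run [] (take s X). (2::real) ^ snd c) \<le> t * \<epsilon> + 9 * \<beta>" .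
      moreover have "real (\<Sum>c\<leftarrow>cs. 2 ^ snd c) = (\<Sum>c\<leftarrow>cs. (2::real) ^ snd c)" for cs :: "block list"
        by (induction cs) auto
      moreover have "real (N - t) < real (\<Sum>c\<leftarrow>run [] (take s X). 2 ^ snd c)"
        using heavy unfolding len of_nat_less_iff .
      ultimately have "real N + \<beta> < t * (1 + \<epsilon>) + 10 * \<beta>" using st len by (simp add: of_nat_diff algebra_simps)
      also have "10 * \<beta> \<le> 10 * \<beta> * (1 + \<epsilon>)" using \<beta> \<epsilon> by (simp add: algebra_simps)
      finally have "real N + \<beta> < (t + 10 * \<beta>) * (1 + \<epsilon>)" by (simp add: algebra_simps)
      then have "(real N + \<beta>) / (1 + \<epsilon>) < t + 10 * \<beta>" using \<epsilon> by (simp add: pos_divide_less_eq)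
      then have "real T < t + (10 * \<beta> + 1)" using T by linarith
      then show ?thesis unfolding K_def by linarith
    qed
  qed
  then have "real (C_GP X) \<le> real (run_cost [] (take T X)) + K + L" by linarith
  moreover have "real K \<le> 10 * \<beta> + 2" using \<beta> unfolding K_def by linarith
  moreover have "real L \<le> 2 * sqrt N + 1" unfolding L_def by (simp add: of_nat_floor)
  moreover have "\<bar>of_int (bal (take T X))\<bar> < T * \<epsilon> + \<beta>"
  proof -
    have "\<bar>\<sigma> * real_of_int (bal (take T X))\<bar> = \<bar>of_int (bal (take T X))\<bar>" using \<sigma> by (simp add: abs_mult)
    moreover have "0 \<le> T * \<epsilon>" using \<epsilon> by simp
    ultimately show ?thesis using dev\<sigma>[OF T(1)] by linarith
  qed
  moreover have "(2 * real T + T * \<epsilon>) / 3 \<le> 2 / 3 * N - \<bar>of_int D\<bar> / 6 + 2 / 3 * \<beta> + 1"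
  proof -
    define \<tau> where "\<tau> = (N + \<beta>) / (1 + \<epsilon>)"
    have \<tau>: "\<tau> * (1 + \<epsilon>) = N + \<beta>" "real T \<le> \<tau> + 1" using \<epsilon> T by (auto simp: \<tau>_def)
    have "(2 + \<epsilon>) / 3 * T \<le> (2 + \<epsilon>) / 3 * (\<tau> + 1)" using \<epsilon> \<tau> by (intro mult_left_mono) auto
    also have "\<dots> \<le> (2 + \<epsilon>) / 3 * \<tau> + 1" using \<epsilon> unfolding distrib_left by simp
    \<comment> \<open>The convex function (2 + \<epsilon>) / (3 (1 + \<epsilon>)) lies below its
      chord 2/3 - \<epsilon>/6 on [0,1]. Equality at both ends is where the slope |D|/6 comes
      from.\<close>
    also have "(2 + \<epsilon>) / 3 * \<tau> \<le> (2 / 3 - \<epsilon> / 6) * (\<tau> * (1 + \<epsilon>))"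
    proof -
      have "0 \<le> \<tau>" using \<epsilon> \<beta> by (simp add: \<tau>_def)
      have "0 \<le> \<epsilon> * (1 - \<epsilon>)" using \<epsilon> by simp
      then have "(2 + \<epsilon>) / 3 \<le> (2 / 3 - \<epsilon> / 6) * (1 + \<epsilon>)" by (simp add: field_simps)
      then have "(2 + \<epsilon>) / 3 * \<tau> \<le> (2 / 3 - \<epsilon> / 6) * (1 + \<epsilon>) * \<tau>" using \<open>0 \<le> \<tau>\<close> by (intro mult_right_mono)
      then show ?thesis by (simp only: mult.assoc mult.commute[of \<tau>])
    qed
    also have "(2 / 3 - \<epsilon> / 6) * (\<tau> * (1 + \<epsilon>)) = 2 / 3 * N - (N * \<epsilon>) / 6 + (2 / 3 - \<epsilon> / 6) * \<beta>"
      unfolding \<tau> by (simp add: field_simps)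
    also have "(2 / 3 - \<epsilon> / 6) * \<beta> \<le> 2 / 3 * \<beta>" using \<epsilon> \<beta> by (intro mult_right_mono) auto
    finally show ?thesis unfolding N\<epsilon> by (simp add: algebra_simps)
  qed
  moreover have "(a + b) / 3 \<le> c + 2 / 3 * \<beta> + 1 \<Longrightarrow> w < b + \<beta> \<Longrightarrow> p < (a + w) / 3 + \<gamma>
      \<Longrightarrow> p < c + \<gamma> + \<beta> + 1" for a b c w p
    by (simp add: field_simps)
  ultimately have "real (pair_queries (take T X)) < 2 / 3 * N - \<bar>of_int D\<bar> / 6 + \<gamma> + \<beta> + 1"
    using queries by blast
  then show ?thesis
    using \<open>real (C_GP X) \<le> _\<close> \<open>real K \<le> _\<close> \<open>real L \<le> _\<close> unfolding run_cost_eq_pair_queries by linarith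
qed

text \<open>With q = sqrt (r/N) the parameters are \<theta> = q/4 and \<nu> = q/2, admissible
  because r \<le> N gives q \<le> 1. The choices of \<beta> and \<gamma> make the exponents r - 5r
  and at most r/2 - 9r/2, both at most -4r; then 229 = 9 + 11 * 20 and 5 = 4 + 1.\<close>

lemma C_GP_tail:
  fixes r :: real
  assumes N: "0 < N" and r: "0 \<le> r" "r \<le> N"
  shows "real (card {X \<in> strs N D.
             2 / 3 * N - \<bar>of_int D\<bar> / 6 + 229 * sqrt (r * N) + 2 * sqrt N + 4 \<le> real (C_GP X)})
           \<le> 5 * exp (- 4 * r) * nstrs N D"
proof -
  define q where "q = sqrt (r / N)"
  define \<beta> where "\<beta> = 20 * sqrt (r * N)"
  define \<gamma> where "\<gamma> = 9 * sqrt (r * N)"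
  define T where "T = decision_time N D \<beta>"
  have q: "0 \<le> q" "q \<le> 1" "q\<^sup>2 * N = r" "q * sqrt (r * N) = r"
  proof -
    have "q * sqrt (r * N) = sqrt (r * r)" unfolding q_def using N by (simp flip: real_sqrt_mult)
    then show "q * sqrt (r * N) = r" using r by simp
  qed (use N r in \<open>auto simp: q_def\<close>)
  have TN: "T \<le> N" by (simp add: T_def decision_time_def)
  let ?A = "{X \<in> strs N D. \<exists>s\<le>N. \<beta> \<le> \<bar>of_int (bal (take s X)) - s * (of_int D / N)\<bar>}"
  let ?B = "{X \<in> strs N D. (2 * real T + \<bar>of_int (bal (take T X))\<bar>) / 3 + \<gamma> \<le> pair_queries (take T X)}"
  let ?C = "{X \<in> strs N D. 2 / 3 * N - \<bar>of_int D\<bar> / 6 + 229 * sqrt (r * N) + 2 * sqrt N + 4 \<le> real (C_GP X)}"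
  have "?C \<subseteq> ?A \<union> ?B"
  proof
    fix X assume X: "X \<in> ?C"
    show "X \<in> ?A \<union> ?B"
    proof (rule ccontr)
      assume not: "X \<notin> ?A \<union> ?B"
      have "real (C_GP X) < 2 / 3 * N - \<bar>of_int D\<bar> / 6 + \<gamma> + 11 * \<beta> + 2 * sqrt N + 4"
      proof (rule C_GP_typical[OF N])
        show "X \<in> strs N D" using X by simp
        show "0 \<le> \<beta>" using r by (simp add: \<beta>_def)
        show "\<bar>of_int (bal (take s X)) - s * (of_int D / N)\<bar> < \<beta>" if "s \<le> N" for s
        proof (rule ccontr)
          assume "\<not> ?thesis"
          then have "X \<in> ?A" using that X by (blast intro: leI)
          then show False using not by blast
        qed
        show "pair_queries (take (decision_time N D \<beta>) X)
            < (2 * real (decision_time N D \<beta>) + \<bar>of_int (bal (take (decision_time N D \<beta>) X))\<bar>) / 3 + \<gamma>"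
        proof (rule ccontr)
          assume "\<not> ?thesis"
          then have "X \<in> ?B" using X unfolding T_def by (blast intro: leI)
          then show False using not by blast
        qed
      qed
      then show False using X by (simp add: \<beta>_def \<gamma>_def)
    qed
  qed
  then have "card ?C \<le> card (?A \<union> ?B)" by (intro card_mono) auto
  also have "\<dots> \<le> card ?A + card ?B" by (rule card_Un_le)
  finally have "real (card ?C) \<le> real (card ?A) + real (card ?B)" by linarith
  moreover have "real (card ?A) \<le> 4 * nstrs N D * exp (- 4 * r)"
  proof -
    have "16 * (q / 4)\<^sup>2 * N - q / 4 * \<beta> = q\<^sup>2 * N - 5 * (q * sqrt (r * N))"
      by (simp add: power_divide \<beta>_def)
    then have "16 * (q / 4)\<^sup>2 * N - q / 4 * \<beta> = - 4 * r" using q by simp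
    then show ?thesis using fluctuation[OF N, of "q / 4" \<beta> D] q r by (simp add: \<beta>_def)
  qed
  moreover have "real (card ?B) \<le> nstrs N D * exp (- 4 * r)"
  proof -
    have "q\<^sup>2 * T \<le> q\<^sup>2 * N" using TN by (intro mult_left_mono) auto
    then have "2 * (q / 2)\<^sup>2 * T - q / 2 * \<gamma> \<le> q\<^sup>2 * N / 2 - 9 / 2 * (q * sqrt (r * N))"
      by (simp add: power_divide \<gamma>_def)
    then have "2 * (q / 2)\<^sup>2 * T - q / 2 * \<gamma> \<le> - 4 * r" using q by simp
    then have "nstrs N D * exp (2 * (q / 2)\<^sup>2 * T - q / 2 * \<gamma>) \<le> nstrs N D * exp (- 4 * r)"
      by (intro mult_left_mono) auto
    then show ?thesis using markov_pair_queries[of "q / 2" T N D \<gamma>] q TN by linarith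
  qed
  moreover have "4 * nstrs N D * exp (- 4 * r) + nstrs N D * exp (- 4 * r) = 5 * exp (- 4 * r) * nstrs N D"
    by (simp add: algebra_simps)
  ultimately show ?thesis by linarith
qed

theorem mainTheorem7:
  shows "\<exists>d::real. \<forall>(N::nat) (A::nat) (B::nat) (r::real).
           N > 0 \<longrightarrow> A + B = N \<longrightarrow> r \<ge> 1 \<longrightarrow>
           real (card {X \<in> strings_with N A.
                   real (C_GP X) \<ge> real N / 2 + real (min A B) / 3 + d * sqrt (r * real N)})
             / real (card (strings_with N A))
           \<le> 2 powr (- r) * log 2 (real N)"
proof (intro exI[of _ 235] allI impI)
  fix N A B :: nat and r :: real
  assume N: "N > 0" and AB: "A + B = N" and r: "r \<ge> 1"
  define D where "D = 2 * int A - int N"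
  have strings: "strings_with N A = strs N D" by (simp add: strings_with_eq D_def)
  let ?bad = "{X \<in> strings_with N A. real (C_GP X) \<ge> real N / 2 + real (min A B) / 3 + 235 * sqrt (r * real N)}"
  show "real (card ?bad) / real (card (strings_with N A)) \<le> 2 powr (- r) * log 2 (real N)"
  proof (cases "r < N")
    \<comment> \<open>For r \<ge> N the threshold exceeds N, and no run makes more than N queries.
      This covers N = 1, where the right-hand side is 0.\<close>
    case False
    have "real N = sqrt (real N * N)" by simp
    also have "\<dots> \<le> sqrt (r * N)" using False by (intro real_sqrt_le_mono mult_right_mono) auto
    finally have "real N \<le> sqrt (r * N)" .
    then have "real N < real N / 2 + real (min A B) / 3 + 235 * sqrt (r * N)" using N by linarith
    moreover have "real (C_GP X) \<le> real N" if "X \<in> strings_with N A" for X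
      using that C_GP_le_length[of X] by (simp add: strings_with_def)
    ultimately have empty: "?bad = {}" by fastforce
    have "card ?bad = 0" unfolding empty by simp
    moreover have "0 \<le> log 2 (real N)" using N by simp
    ultimately show ?thesis by simp
  next
    case True
    have "1 \<le> real N" using N by simp
    moreover have "real N \<le> r * N" using r mult_right_mono[of 1 r "real N"] by simp
    ultimately have "1 \<le> r * N" "real N \<le> r * N" by linarith+
    then have root: "sqrt N \<le> sqrt (r * N)" "1 \<le> sqrt (r * N)" by simp_all
    have "real (min A B) = (real N - \<bar>of_int D\<bar>) / 2" using AB by (auto simp: D_def min_def)
    then have "real N / 2 + real (min A B) / 3 = 2 / 3 * N - \<bar>of_int D\<bar> / 6" by simp
    \<comment> \<open>Both sqrt N and 1 are at most sqrt (rN), so 229 + 2 + 4 = 235.\<close>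
    then have le: "2 / 3 * N - \<bar>of_int D\<bar> / 6 + 229 * sqrt (r * N) + 2 * sqrt N + 4
        \<le> real N / 2 + real (min A B) / 3 + 235 * sqrt (r * N)" using root by linarith
    have "?bad \<subseteq> {X \<in> strs N D.
        2 / 3 * N - \<bar>of_int D\<bar> / 6 + 229 * sqrt (r * N) + 2 * sqrt N + 4 \<le> real (C_GP X)}"
      unfolding strings using order_trans[OF le] by blast
    then have "real (card ?bad) \<le> real (card {X \<in> strs N D.
        2 / 3 * N - \<bar>of_int D\<bar> / 6 + 229 * sqrt (r * N) + 2 * sqrt N + 4 \<le> real (C_GP X)})"
      by (intro of_nat_mono card_mono) auto
    also have "\<dots> \<le> 5 * exp (- 4 * r) * nstrs N D"
      using N r True by (intro C_GP_tail) auto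
    finally have "real (card ?bad) / real (card (strings_with N A)) \<le> 5 * exp (- 4 * r)"
      by (simp add: strings nstrs_def divide_le_eq)
    \<comment> \<open>The surplus in the rate -4r absorbs the factor 5, as exp 3 is at least
      8.5.\<close>
    also have "\<dots> \<le> exp (3 * r) * exp (- 4 * r)"
    proof -
      have "1 + 3 * 1 + (3 * 1)\<^sup>2 / 2 \<le> exp (3 * 1 :: real)" by (rule exp_lower_Taylor_quadratic) simp
      also have "\<dots> \<le> exp (3 * r)" using r by simp
      finally show ?thesis by (intro mult_right_mono) auto
    qed
    also have "\<dots> = exp (- r)" by (simp flip: exp_add)
    also have "\<dots> \<le> 2 powr (- r) * 1"
      using r ln_2_less_1 by (simp add: powr_def mult_left_le)
    \<comment> \<open>Since 1 \<le> r < N forces N \<ge> 2, the logarithm is at least 1.\<close>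
    also have "\<dots> \<le> 2 powr (- r) * log 2 (real N)"
      using r True by (intro mult_left_mono) auto
    finally show ?thesis .
  qed
qed

end
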